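(* Let $\alpha,\beta$ be compositions and $n$ be a positive integer. Then $$\mathcal{S}_{\alpha/\!\!/\beta}\cdot\mathcal{S}_{(n)}=\sum_{i+j=n}(-1)^j\,\mathcal{S}_{\alpha^+/\!\!/\beta^-},$$ where the sum is over all integers $i,j\ge0$ with $i+j=n$, all compositions $\alpha^+$ such that $\alpha$ can be obtained by removing an $i$-horizontal strip from $\alpha^+$, and all compositions $\beta^-$ such that $\beta^-$ can be obtained by removing a $j$-vertical strip from $\beta$. Similarly, $$\mathcal{S}_{\alpha/\!\!/\beta}\cdot\mathcal{S}_{(1^n)}=\sum_{i+j=n}(-1)^j\,\mathcal{S}_{\alpha^+/\!\!/\beta^-},$$ where the sum is over all integers $i,j\ge0$ with $i+j=n$, all compositions $\alpha^+$ such that $\alpha$ can be obtained by removing an $i$-vertical strip from $\alpha^+$, and all compositions $\beta^-$ such that $\beta^-$ can be obtained by removing a $j$-horizontal strip from $\beta$.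
   Context: **Compositions.** A weak composition is a finite list of nonnegative integers; a composition is a finite list of positive integers (the empty composition $\emptyset$ is allowed). For $\alpha=(\alpha_1,\dots,\alpha_\ell)$ the $\alpha_i$ are its parts and its size is $|\alpha|=\sum\alpha_i$; $(1^n)$ is the composition with $n$ parts equal to $1$. The diagram of $\alpha$ is the array of left-justified boxes with $\alpha_i$ boxes in row $i$ from the top. For a subset $S=\{s_1<\cdots<s_m\}\subseteq[N-1]$ let $\mathrm{comp}(S)=(s_1,s_2-s_1,\dots,N-s_m)$, with $\mathrm{comp}(\emptyset)=(N)$ for $N\ge1$; for $\alpha=(\alpha_1,\dots,\alpha_\ell)$ let $\mathrm{set}(\alpha)=\{\alpha_1,\alpha_1+\alpha_2,\dots,\alpha_1+\cdots+\alpha_{\ell-1}\}$. **Removing strips.** For $i\ge1$ and a weak composition $\alpha$, $\mathfrak{d}_i(\alpha)$ is the weak composition obtained by subtracting $1$ from the rightmost part of $\alpha$ equal to $i$; if there is no such part, $\mathfrak{d}_i(\alpha)=0$ (not a valid weak composition, and all operators send $0$ to $0$). Products of operators are compositions of maps, the rightmost acting first. For $i_1<\cdots<i_k$ positive integers, if $\mathfrak{d}_{i_1}\cdots\mathfrak{d}_{i_k}(\alpha)$ is a valid weak composition, it is said to be obtained from $\alpha$ by removing a $k$-horizontal strip. For positive integers $i_1\ge\cdots\ge i_k$, if $\mathfrak{d}_{i_1}\cdots\mathfrak{d}_{i_k}(\alpha)$ is a valid weak composition, it is said to be obtained from $\alpha$ by removing a $k$-vertical strip. Removing a $0$-strip of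 either kind leaves $\alpha$ unchanged. Convention: any parts equal to $0$ that arise are ignored, i.e. a resulting weak composition is replaced by the composition obtained by deleting its zeros. Each composition $\alpha^+$ (resp. $\beta^-$) satisfying the stated condition is counted once. **Composition poset.** For a composition $\alpha=(\alpha_1,\dots,\alpha_\ell)$ set $\mathfrak{t}_1(\alpha)=(1,\alpha_1,\dots,\alpha_\ell)$, and for $i\ge2$ let $\mathfrak{t}_i(\alpha)$ be obtained from $\alpha$ by adding $1$ to the leftmost part equal to $i-1$ (and $\mathfrak{t}_i(\alpha)=0$, i.e. undefined, if there is no such part). The composition poset $\mathcal{L}_c$ is the set of all compositions with cover relation $\beta\lessdot_c\alpha$ iff $\alpha=\mathfrak{t}_i(\beta)$ for some $i\ge1$; $<_c$ is its transitive closure. **Quasisymmetric functions.** $\mathrm{QSym}\subset\mathbb{C}[[x_1,x_2,\dots]]$ is the algebra (with product of power series) with basis the fundamental quasisymmetric functions $F_\emptyset=1$ and $F_\alpha=\sum x_{i_1}\cdots x_{i_{|\alpha|}}$, summed over $i_1\le\cdots\le i_{|\alpha|}$ with $i_j<i_{j+1}$ if $j\in\mathrm{set}(\alpha)$. **Skew quasisymmetric Schur functions.** If $\beta<_c\alpha$, the skew composition diagram $\alpha/\!\!/\beta$ is the array of boxes added in a saturated chain from $\beta$ to $\alpha$ in $\mathcal{L}_c$ (so $\mathfrak{t}_1$ adds a new top row consisting of one box, and $\mathfrak{t}_i$ with $i\geq 2$ adds a box in column $i$); its size is $N=|\alpha|-|\beta|$. A standard skew composition tableau of shape $\alpha/\!\!/\beta$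 is obtained from a saturated chain $\beta=\alpha^0\lessdot_c\alpha^1\lessdot_c\cdots\lessdot_c\alpha^N=\alpha$ by putting the number $N-k+1$ in the box of $\alpha^k$ not in $\alpha^{k-1}$, for $1\le k\le N$. Its descent set is $\mathrm{Des}(\tau)=\{i: i+1\text{ appears weakly right of }i\}\subseteq[N-1]$ (comparison of columns), and $\mathrm{comp}(\tau)=\mathrm{comp}(\mathrm{Des}(\tau))$. Then $\mathcal{S}_{\alpha/\!\!/\beta}=\sum_\tau F_{\mathrm{comp}(\tau)}$, summed over all standard skew composition tableaux $\tau$ of shape $\alpha/\!\!/\beta$. Also $\mathcal{S}_{\alpha/\!\!/\alpha}=1$, and $\mathcal{S}_{\alpha/\!\!/\beta}=0$ if $\beta\ne\alpha$ and $\beta\not<_c\alpha$. The quasisymmetric Schur function is $\mathcal{S}_\alpha=\mathcal{S}_{\alpha/\!\!/\emptyset}$ (e.g. $\mathcal{S}_{(n)}=F_{(n)}$, $\mathcal{S}_{(1^n)}=F_{(1^n)}$). *)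

theory Defs
  imports Complex_Main "HOL-Library.Poly_Mapping"
begin

section \<open>Formal power series in countably many variables\<close>

text \<open>A monomial is its finitely supported exponent function. Variables are numbered from 0, so
  index \<open>i\<close> stands for the variable usually written \<open>x\<close> with subscript \<open>i + 1\<close>.\<close>

type_synonym monomial = "nat \<Rightarrow>\<^sub>0 nat"

typedef power_series = "UNIV :: (monomial \<Rightarrow> complex) set"
  morphisms ps_coeff Abs_ps by simp

setup_lifting type_definition_power_series

lemma power_series_eqI: "(\<And>m. ps_coeff f m = ps_coeff g m) \<Longrightarrow> f = g"
  by (auto simp: ps_coeff_inject[symmetric])

definition splits :: "monomial \<Rightarrow> (monomial \<times> monomial) set"
  where "splits m = {(a, b). a + b = m}"

lemma finite_splits [simp]: "finite (splits m)"
proof -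
  let ?A = "{a :: monomial. \<exists>b. a + b = m}"
  let ?K = "Poly_Mapping.keys m"
  let ?N = "Max (insert 0 (Poly_Mapping.lookup m ` ?K))"
  have "finite {f. \<forall>x. (x \<in> ?K \<longrightarrow> f x \<in> {..?N}) \<and> (x \<notin> ?K \<longrightarrow> f x = 0)}"
    by (rule finite_set_of_finite_funs) simp_all
  moreover have "Poly_Mapping.lookup ` ?A \<subseteq>
      {f. \<forall>x. (x \<in> ?K \<longrightarrow> f x \<in> {..?N}) \<and> (x \<notin> ?K \<longrightarrow> f x = 0)}"
  proof clarify
    fix a b :: monomial and x
    assume m: "m = a + b"
    have le: "Poly_Mapping.lookup a x \<le> Poly_Mapping.lookup (a + b) x"
      by (simp add: lookup_add)
    have "Poly_Mapping.lookup (a + b) x \<le> Max (insert 0 (Poly_Mapping.lookup (a + b) ` Poly_Mapping.keys (a + b)))"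
      if "x \<in> Poly_Mapping.keys (a + b)"
      using that by (intro Max_ge) auto
    moreover have "Poly_Mapping.lookup (a + b) x = 0" if "x \<notin> Poly_Mapping.keys (a + b)"
      using that by (simp add: in_keys_iff)
    ultimately show "(x \<in> Poly_Mapping.keys (a + b) \<longrightarrow> Poly_Mapping.lookup a x \<in>
        {..Max (insert 0 (Poly_Mapping.lookup (a + b) ` Poly_Mapping.keys (a + b)))}) \<and>
      (x \<notin> Poly_Mapping.keys (a + b) \<longrightarrow> Poly_Mapping.lookup a x = 0)"
      using le by (metis atMost_iff bot_nat_0.extremum_uniqueI order_trans)
  qed
  ultimately have "finite (Poly_Mapping.lookup ` ?A)"
    using finite_subset by blast
  then have "finite ?A"
    by (rule finite_imageD) (simp add: inj_on_def poly_mapping.lookup_inject)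
  moreover have "splits m \<subseteq> (\<lambda>a. (a, m - a)) ` ?A"
    by (auto simp: splits_def image_iff)
  ultimately show ?thesis
    using finite_subset by blast
qed

instantiation power_series :: comm_ring_1
begin

lift_definition zero_power_series :: power_series is "\<lambda>_. 0" .
lift_definition one_power_series :: power_series is "\<lambda>m. if m = 0 then 1 else 0" .
lift_definition plus_power_series :: "power_series \<Rightarrow> power_series \<Rightarrow> power_series"
  is "\<lambda>f g m. f m + g m" .
lift_definition minus_power_series :: "power_series \<Rightarrow> power_series \<Rightarrow> power_series"
  is "\<lambda>f g m. f m - g m" .
lift_definition uminus_power_series :: "power_series \<Rightarrow> power_series" is "\<lambda>f m. - f m" .
lift_definition times_power_series :: "power_series \<Rightarrow> power_series \<Rightarrow> power_series"
  is "\<lambda>f g m. \<Sum>(a, b)\<in>splits m. f a * g b" .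

instance
proof
  fix f g h :: power_series
  show "f + g + h = f + (g + h)" by transfer (simp add: algebra_simps)
  show "f + g = g + f" by transfer (simp add: algebra_simps)
  show "0 + f = f" by transfer simp
  show "- f + f = 0" by transfer simp
  show "f - g = f + - g" by transfer simp
  show "(0 :: power_series) \<noteq> 1" by transfer (metis zero_neq_one)
  show "(f + g) * h = f * h + g * h"
    by transfer (simp add: algebra_simps sum.distrib case_prod_unfold)
  show "f * g = g * f"
  proof (transfer, rule ext)
    fix f g :: "monomial \<Rightarrow> complex" and m
    show "(\<Sum>(a, b)\<in>splits m. f a * g b) = (\<Sum>(a, b)\<in>splits m. g a * f b)"
      by (rule sum.reindex_bij_witness[where i = prod.swap and j = prod.swap])
         (auto simp: splits_def add.commute mult.commute)
  qed
  show "1 * f = f"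
  proof (transfer, rule ext)
    fix f :: "monomial \<Rightarrow> complex" and m
    have "(\<Sum>(a, b)\<in>splits m. (if a = 0 then 1 else 0) * f b) =
        (\<Sum>(a, b)\<in>{(0 :: monomial, m)}. (if a = 0 then 1 else 0) * f b)"
    proof (rule sum.mono_neutral_right)
      show "{(0 :: monomial, m)} \<subseteq> splits m" by (simp add: splits_def)
      show "\<forall>p\<in>splits m - {(0, m)}. (case p of (a, b) \<Rightarrow> (if a = 0 then 1 else 0) * f b) = 0"
        by (auto simp: splits_def split: if_splits)
    qed simp
    then show "(\<Sum>(a, b)\<in>splits m. (if a = 0 then 1 else 0) * f b) = f m"
      by simp
  qed
  show "f * g * h = f * (g * h)"
  proof (transfer, rule ext)
    fix f g h :: "monomial \<Rightarrow> complex" and m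
    have "(\<Sum>(a, b)\<in>splits m. (\<Sum>(c, d)\<in>splits a. f c * g d) * h b) =
        (\<Sum>(p, q)\<in>(SIGMA p:splits m. splits (fst p)). f (fst q) * g (snd q) * h (snd p))"
      unfolding case_prod_unfold sum_distrib_right by (subst sum.Sigma) (auto simp: case_prod_unfold)
    also have "\<dots> =
        (\<Sum>(p, q)\<in>(SIGMA p:splits m. splits (snd p)). f (fst p) * (g (fst q) * h (snd q)))"
      by (rule sum.reindex_bij_witness
          [where i = "\<lambda>((a, b), (c, d)). ((a + c, d), (a, c))"
             and j = "\<lambda>((a, b), (c, d)). ((c, d + b), (d, b))"])
         (auto simp: splits_def add.assoc mult.assoc)
    also have "\<dots> = (\<Sum>(a, b)\<in>splits m. f a * (\<Sum>(c, d)\<in>splits b. g c * h d))"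
      unfolding case_prod_unfold sum_distrib_left by (subst sum.Sigma) (auto simp: case_prod_unfold)
    finally show "(\<Sum>(a, b)\<in>splits m. (\<Sum>(c, d)\<in>splits a. f c * g d) * h b) =
        (\<Sum>(a, b)\<in>splits m. f a * (\<Sum>(c, d)\<in>splits b. g c * h d))" .
  qed
qed

end


section \<open>Compositions\<close>

text \<open>Weak compositions are lists of natural numbers; the size is \<^const>\<open>sum_list\<close>.\<close>

definition is_composition :: "nat list \<Rightarrow> bool"
  where "is_composition \<alpha> \<longleftrightarrow> (\<forall>a\<in>set \<alpha>. 0 < a)"

definition comp_of_set :: "nat \<Rightarrow> nat set \<Rightarrow> nat list"
  where "comp_of_set N S =
    (let s = sorted_list_of_set S in map2 (-) (s @ [N]) (0 # s))"

definition set_of_comp :: "nat list \<Rightarrow> nat set"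
  where "set_of_comp \<alpha> = {sum_list (take k \<alpha>) | k. 1 \<le> k \<and> k < length \<alpha>}"


section \<open>Removing strips\<close>

text \<open>\<^const>\<open>None\<close> plays the role of the value 0 of an operator that is not applicable.\<close>

definition rem_box :: "nat \<Rightarrow> nat list \<Rightarrow> nat list option"
  where "rem_box i \<alpha> =
    (if i \<in> set \<alpha>
     then Some (\<alpha>[(GREATEST k. k < length \<alpha> \<and> \<alpha> ! k = i) := i - 1])
     else None)"

text \<open>\<open>rem_boxes [i\<^sub>1, \<dots>, i\<^sub>k]\<close> is the product of operators in this order, the last one acting
  first.\<close>

definition rem_boxes :: "nat list \<Rightarrow> nat list \<Rightarrow> nat list option"
  where "rem_boxes is \<alpha> = foldr (\<lambda>i r. Option.bind r (rem_box i)) is (Some \<alpha>)"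

definition drop_zeros :: "nat list \<Rightarrow> nat list"
  where "drop_zeros \<alpha> = filter (\<lambda>a. a \<noteq> 0) \<alpha>"

definition removes_horizontal_strip :: "nat \<Rightarrow> nat list \<Rightarrow> nat list \<Rightarrow> bool"
  where "removes_horizontal_strip k \<alpha> \<gamma> \<longleftrightarrow>
    (\<exists>is \<delta>. length is = k \<and> (\<forall>i\<in>set is. 1 \<le> i) \<and> sorted_wrt (<) is \<and>
      rem_boxes is \<alpha> = Some \<delta> \<and> \<gamma> = drop_zeros \<delta>)"

definition removes_vertical_strip :: "nat \<Rightarrow> nat list \<Rightarrow> nat list \<Rightarrow> bool"
  where "removes_vertical_strip k \<alpha> \<gamma> \<longleftrightarrow>
    (\<exists>is \<delta>. length is = k \<and> (\<forall>i\<in>set is. 1 \<le> i) \<and> sorted_wrt (\<ge>) is \<and>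
      rem_boxes is \<alpha> = Some \<delta> \<and> \<gamma> = drop_zeros \<delta>)"


section \<open>The composition poset\<close>

definition add_box :: "nat \<Rightarrow> nat list \<Rightarrow> nat list option"
  where "add_box i \<alpha> =
    (if i = 1 then Some (1 # \<alpha>)
     else if 2 \<le> i \<and> i - 1 \<in> set \<alpha>
     then Some (\<alpha>[(LEAST k. k < length \<alpha> \<and> \<alpha> ! k = i - 1) := i])
     else None)"

definition covers_c :: "nat list \<Rightarrow> nat list \<Rightarrow> bool"
  where "covers_c \<beta> \<alpha> \<longleftrightarrow> is_composition \<beta> \<and> (\<exists>i\<ge>1. add_box i \<beta> = Some \<alpha>)"

definition less_c :: "nat list \<Rightarrow> nat list \<Rightarrow> bool"
  where "less_c = covers_c\<^sup>+\<^sup>+"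

definition saturated_chain :: "nat list \<Rightarrow> nat list \<Rightarrow> nat list list \<Rightarrow> bool"
  where "saturated_chain \<beta> \<alpha> c \<longleftrightarrow>
    c \<noteq> [] \<and> hd c = \<beta> \<and> last c = \<alpha> \<and> successively covers_c c"


section \<open>Quasisymmetric functions\<close>

definition monomial_of :: "nat list \<Rightarrow> monomial"
  where "monomial_of is = (\<Sum>i\<leftarrow>is. Poly_Mapping.single i 1)"

text \<open>The index words of the monomials of \<open>F\<^sub>\<alpha>\<close>; positions are counted from 0 in
  \<^const>\<open>nth\<close> and from 1 in \<^const>\<open>set_of_comp\<close>.\<close>

definition fundamental_words :: "nat list \<Rightarrow> nat list set"
  where "fundamental_words \<alpha> =
    {is. length is = sum_list \<alpha> \<and> sorted is \<and>
      (\<forall>j\<in>set_of_comp \<alpha>. is ! (j - 1) < is ! j)}"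

definition fundamental :: "nat list \<Rightarrow> power_series"
  where "fundamental \<alpha> =
    Abs_ps (\<lambda>m. of_nat (card {is \<in> fundamental_words \<alpha>. monomial_of is = m}))"


section \<open>Skew quasisymmetric Schur functions\<close>

text \<open>Boxes are pairs (row, column). Rows are numbered from the bottom starting at 0, since adding
  a box never moves the existing boxes relative to the bottom row; columns are numbered from 1.\<close>

type_synonym box = "nat \<times> nat"

definition diagram :: "nat list \<Rightarrow> box set"
  where "diagram \<alpha> = {(r, c). r < length \<alpha> \<and> 1 \<le> c \<and> c \<le> rev \<alpha> ! r}"

text \<open>A filling is given by its graph, a set of pairs of a box and its entry.\<close>

definition tableau_of_chain :: "nat list list \<Rightarrow> (box \<times> nat) set"
  where "tableau_of_chain c =
    (let N = length c - 1 in
      {(b, N - k + 1) | b k. 1 \<le> k \<and> k \<le> N \<and> b \<in> diagram (c ! k) - diagram (c ! (k - 1))})"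

definition standard_tableaux :: "nat list \<Rightarrow> nat list \<Rightarrow> (box \<times> nat) set set"
  where "standard_tableaux \<alpha> \<beta> = tableau_of_chain ` {c. saturated_chain \<beta> \<alpha> c}"

definition descents :: "(box \<times> nat) set \<Rightarrow> nat set"
  where "descents \<tau> =
    {i. \<exists>r c r' c'. ((r, c), i) \<in> \<tau> \<and> ((r', c'), i + 1) \<in> \<tau> \<and> c \<le> c'}"

definition skew_schur :: "nat list \<Rightarrow> nat list \<Rightarrow> power_series"
  where "skew_schur \<alpha> \<beta> =
    (if \<alpha> = \<beta> then 1
     else if less_c \<beta> \<alpha>
     then \<Sum>\<tau>\<in>standard_tableaux \<alpha> \<beta>.
            fundamental (comp_of_set (sum_list \<alpha> - sum_list \<beta>) (descents \<tau>))
     else 0)"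

abbreviation quasi_schur :: "nat list \<Rightarrow> power_series"
  where "quasi_schur \<alpha> \<equiv> skew_schur \<alpha> []"


section \<open>Finiteness of the index sets\<close>

lemma finite_compositions: "finite {\<alpha>. is_composition \<alpha> \<and> sum_list \<alpha> \<le> n}"
proof -
  have len: "length \<alpha> \<le> sum_list \<alpha>" if "is_composition \<alpha>" for \<alpha>
    using that by (induction \<alpha>) (auto simp: is_composition_def)
  have "{\<alpha>. is_composition \<alpha> \<and> sum_list \<alpha> \<le> n} \<subseteq> {xs. set xs \<subseteq> {..n} \<and> length xs \<le> n}"
    using len member_le_sum_list by (auto intro: order_trans)
  then show ?thesis
    using finite_lists_length_le[of "{..n}" n] finite_subset by blast
qed

lemma rem_box_size:
  assumes "rem_box i \<alpha> = Some \<gamma>" "1 \<le> i"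
  shows "sum_list \<alpha> = Suc (sum_list \<gamma>)"
proof -
  let ?P = "\<lambda>k. k < length \<alpha> \<and> \<alpha> ! k = i"
  let ?k = "Greatest ?P"
  have i: "i \<in> set \<alpha>" and g: "\<gamma> = \<alpha>[?k := i - 1]"
    using assms(1) by (auto simp: rem_box_def split: if_splits)
  then obtain k where "?P k" by (auto simp: in_set_conv_nth)
  then have k: "?P ?k"
    by (rule GreatestI_nat[where b = "length \<alpha>"]) auto
  then have "i \<le> sum_list \<alpha>" by (metis elem_le_sum_list)
  with k g assms(2) show ?thesis by (simp add: sum_list_update)
qed

lemma rem_boxes_size:
  assumes "rem_boxes is \<alpha> = Some \<gamma>" "\<forall>i\<in>set is. 1 \<le> i"
  shows "sum_list \<alpha> = sum_list \<gamma> + length is"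
  using assms
proof (induction "is" arbitrary: \<gamma>)
  case (Cons i js)
  then obtain \<delta> where d: "rem_boxes js \<alpha> = Some \<delta>" "rem_box i \<delta> = Some \<gamma>"
    by (auto simp: rem_boxes_def bind_eq_Some_conv)
  have "sum_list \<alpha> = sum_list \<delta> + length js"
    using Cons.IH[OF d(1)] Cons.prems(2) by simp
  with rem_box_size[OF d(2)] Cons.prems(2) show ?case by simp
qed (simp add: rem_boxes_def)

lemma sum_list_drop_zeros [simp]: "sum_list (drop_zeros \<alpha>) = sum_list \<alpha>"
  by (induction \<alpha>) (auto simp: drop_zeros_def)

lemma strip_size:
  assumes "removes_horizontal_strip k \<alpha> \<gamma> \<or> removes_vertical_strip k \<alpha> \<gamma>"
  shows "sum_list \<alpha> = sum_list \<gamma> + k"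
proof -
  obtain "is" \<delta> where "length is = k" "\<forall>i\<in>set is. 1 \<le> i" "rem_boxes is \<alpha> = Some \<delta>"
    "\<gamma> = drop_zeros \<delta>"
    using assms unfolding removes_horizontal_strip_def removes_vertical_strip_def by blast
  then show ?thesis using rem_boxes_size[of "is" \<alpha> \<delta>] by simp
qed

lemma finite_strip_index_sets:
  shows "finite {\<alpha>p. is_composition \<alpha>p \<and> removes_horizontal_strip k \<alpha>p \<alpha>}"
    and "finite {\<alpha>p. is_composition \<alpha>p \<and> removes_vertical_strip k \<alpha>p \<alpha>}"
    and "finite {\<beta>m. is_composition \<beta>m \<and> removes_horizontal_strip k \<beta> \<beta>m}"
    and "finite {\<beta>m. is_composition \<beta>m \<and> removes_vertical_strip k \<beta> \<beta>m}"
proof -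
  let ?A = "{\<gamma>. is_composition \<gamma> \<and> sum_list \<gamma> \<le> sum_list \<alpha> + k}"
  have "sum_list \<alpha>p \<le> sum_list \<alpha> + k"
    if "removes_horizontal_strip k \<alpha>p \<alpha> \<or> removes_vertical_strip k \<alpha>p \<alpha>" for \<alpha>p
    using strip_size[OF that] by simp
  then have "{\<alpha>p. is_composition \<alpha>p \<and> removes_horizontal_strip k \<alpha>p \<alpha>} \<subseteq> ?A"
    and "{\<alpha>p. is_composition \<alpha>p \<and> removes_vertical_strip k \<alpha>p \<alpha>} \<subseteq> ?A"
    by blast+
  then show "finite {\<alpha>p. is_composition \<alpha>p \<and> removes_horizontal_strip k \<alpha>p \<alpha>}"
    and "finite {\<alpha>p. is_composition \<alpha>p \<and> removes_vertical_strip k \<alpha>p \<alpha>}"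
    using finite_compositions finite_subset by blast+
  let ?B = "{\<gamma>. is_composition \<gamma> \<and> sum_list \<gamma> \<le> sum_list \<beta>}"
  have "sum_list \<beta>m \<le> sum_list \<beta>"
    if "removes_horizontal_strip k \<beta> \<beta>m \<or> removes_vertical_strip k \<beta> \<beta>m" for \<beta>m
    using strip_size[OF that] by simp
  then have "{\<beta>m. is_composition \<beta>m \<and> removes_horizontal_strip k \<beta> \<beta>m} \<subseteq> ?B"
    and "{\<beta>m. is_composition \<beta>m \<and> removes_vertical_strip k \<beta> \<beta>m} \<subseteq> ?B"
    by blast+
  then show "finite {\<beta>m. is_composition \<beta>m \<and> removes_horizontal_strip k \<beta> \<beta>m}"
    and "finite {\<beta>m. is_composition \<beta>m \<and> removes_vertical_strip k \<beta> \<beta>m}"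
    using finite_compositions finite_subset by blast+
qed

lemma add_box_size:
  assumes "add_box i \<alpha> = Some \<gamma>"
  shows "sum_list \<gamma> = Suc (sum_list \<alpha>)"
proof (cases "i = 1")
  case False
  let ?P = "\<lambda>k. k < length \<alpha> \<and> \<alpha> ! k = i - 1"
  let ?k = "Least ?P"
  have i: "i - 1 \<in> set \<alpha>" "2 \<le> i" and g: "\<gamma> = \<alpha>[?k := i]"
    using assms False by (auto simp: add_box_def split: if_splits)
  then obtain k where "?P k" by (auto simp: in_set_conv_nth)
  then have k: "?P ?k" by (rule LeastI)
  then have "i - 1 \<le> sum_list \<alpha>" by (metis elem_le_sum_list)
  with k g i show ?thesis by (simp add: sum_list_update)
qed (use assms in \<open>auto simp: add_box_def\<close>)

lemma covers_c_composition:
  assumes "covers_c \<beta> \<alpha>"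
  shows "is_composition \<beta>" "is_composition \<alpha>" "sum_list \<alpha> = Suc (sum_list \<beta>)"
proof -
  obtain i where b: "is_composition \<beta>" and i: "add_box i \<beta> = Some \<alpha>"
    using assms by (auto simp: covers_c_def)
  show "is_composition \<beta>" by (fact b)
  show "sum_list \<alpha> = Suc (sum_list \<beta>)" using add_box_size[OF i] .
  have "set \<alpha> \<subseteq> insert i (set \<beta>)" "1 \<le> i"
    using i set_update_subset_insert[of \<beta> _ i] by (auto simp: add_box_def split: if_splits)
  with b show "is_composition \<alpha>" by (fastforce simp: is_composition_def)
qed

lemma chain_bounds:
  assumes "successively covers_c c" "c \<noteq> []" "is_composition (last c)"
  shows "(\<forall>\<gamma>\<in>set c. is_composition \<gamma> \<and> sum_list \<gamma> \<le> sum_list (last c)) \<and>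
    sum_list (hd c) + length c = Suc (sum_list (last c))"
  using assms
proof (induction c)
  case (Cons a c)
  show ?case
  proof (cases c)
    case Nil
    with Cons show ?thesis by simp
  next
    case (Cons b d)
    have ab: "covers_c a b" and c: "successively covers_c c" "c \<noteq> []" "is_composition (last c)"
      using Cons.prems Cons by simp_all
    have l: "last (a # c) = last c" and h: "hd c = b" using Cons by simp_all
    have IH: "(\<forall>\<gamma>\<in>set c. is_composition \<gamma> \<and> sum_list \<gamma> \<le> sum_list (last c)) \<and>
        sum_list b + length c = Suc (sum_list (last c))"
      using Cons.IH[OF c] h by simp
    moreover have "b \<in> set c" using Cons by simp
    ultimately show ?thesis
      unfolding l using covers_c_composition[OF ab] by auto
  qed
qed simp

lemma finite_standard_tableaux:
  assumes "is_composition \<alpha>"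
  shows "finite (standard_tableaux \<alpha> \<beta>)"
proof -
  let ?C = "{\<gamma>. is_composition \<gamma> \<and> sum_list \<gamma> \<le> sum_list \<alpha>}"
  have "set c \<subseteq> ?C \<and> length c \<le> Suc (sum_list \<alpha>)" if "saturated_chain \<beta> \<alpha> c" for c
    using chain_bounds[of c] that assms by (auto simp: saturated_chain_def)
  then have "{c. saturated_chain \<beta> \<alpha> c} \<subseteq> {c. set c \<subseteq> ?C \<and> length c \<le> Suc (sum_list \<alpha>)}"
    by blast
  then have "finite {c. saturated_chain \<beta> \<alpha> c}"
    using finite_lists_length_le[OF finite_compositions] finite_subset by blast
  then show ?thesis by (simp add: standard_tableaux_def)
qed

lemma finite_fundamental_words: "finite {is \<in> fundamental_words \<alpha>. monomial_of is = m}"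
proof -
  have keys: "set is \<subseteq> Poly_Mapping.keys (monomial_of is)" for "is"
    by (induction "is") (auto simp: monomial_of_def in_keys_iff lookup_add lookup_single)
  have "{is \<in> fundamental_words \<alpha>. monomial_of is = m} \<subseteq>
      {xs. set xs \<subseteq> Poly_Mapping.keys m \<and> length xs = sum_list \<alpha>}"
    using keys by (auto simp: fundamental_words_def)
  then show ?thesis
    using finite_lists_length_eq[OF finite_keys] finite_subset by blast
qed

end

(* Let t_i and d_i be the operators that add, respectively remove, a box in column i, where parts
   that become 0 are deleted. They commute for different indices, and
     d_i t_i - t_i d_i = N_i - N_(i-1),
   where N_i projects to the compositions without a part i and N_0 = 0. Put
     T(x) = ... (1 + x t_2) (1 + x t_1)   and   D(z) = (1 + z d_1) (1 + z d_2) ...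
   Induction on the number of factors gives
     (1 - x z) D(z) T(x) = T(x) D(z);
   for truncated products there is an error term, which vanishes on every composition once the
   truncation is large enough.

   The skew function of alpha and beta is the matrix coefficient <alpha| M |beta> of
   M = T(x_1) T(x_2) ..., and D(z) generates the removals of horizontal strips, D(-z)^(-1) those of
   vertical strips. Hence the two right hand sides are the coefficients of z^n in
     D(z) M D(z)^(-1) = M / prod (1 - x_i z)   and   D(-z)^(-1) M D(-z) = M prod (1 + x_i z). *)

theory Submission
  imports Defs "HOL-Computational_Algebra.Formal_Power_Series"
begin

unbundle fps_syntax

section \<open>Ordered products\<close>

text \<open>A box goes to the leftmost suitable part and is taken from the rightmost one, so adding
  and removing in one column fail to commute only where exactly one of the two finds a part to act
  on; the projections N_i record this. For products truncated after column m the correction is x z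
  times the products truncated after column m - 1, followed by N_m. On a fixed composition N_m is
  the identity once m exceeds every part that can arise, so the correction becomes the product
  itself: this is the origin of the factor 1 - x z.

  No infinite product is formed. Operators act on all complex functions on lists by pull-back, so a
  sum over infinitely many words makes sense as long as finitely many of them apply to each list.
  Identities are checked for one coefficient at one list, where sizes bound the columns that matter.
  Vertical strips invert signed horizontal ones because ordered products of geometric series cancel
  from the inside.\<close>

fun prod_up :: "(nat \<Rightarrow> 'a::ring_1) \<Rightarrow> 'a \<Rightarrow> nat \<Rightarrow> 'a" where
  "prod_up t x 0 = 1"
| "prod_up t x (Suc m) = prod_up t x m * (1 + x * t (Suc m))"

fun prod_down :: "(nat \<Rightarrow> 'a::ring_1) \<Rightarrow> 'a \<Rightarrow> nat \<Rightarrow> 'a" where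
  "prod_down d z 0 = 1"
| "prod_down d z (Suc m) = (1 + z * d (Suc m)) * prod_down d z m"

text \<open>Here \<open>t i\<close> and \<open>d i\<close> stand for adding and removing a box in column \<open>i\<close>, acting contravariantly on
  functions, and \<open>N i\<close> for the projection to the compositions without a part \<open>i\<close>.\<close>

locale ladder =
  fixes t d N :: "nat \<Rightarrow> 'a::ring_1"
  assumes comm: "i \<noteq> j \<Longrightarrow> t (Suc i) * d (Suc j) = d (Suc j) * t (Suc i)"
    and comm_same: "t (Suc i) * d (Suc i) = d (Suc i) * t (Suc i) + N (Suc i) - N i"
    and N_0: "N 0 = 0"
    and N_t: "N i * t (Suc i) = 0"
    and N_d: "N (Suc i) * d (Suc i) = 0"
    and t_N: "t (Suc i) * N (Suc i) = 0"
    and d_N: "d (Suc i) * N i = 0"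
    and N_comm_t: "i < j \<Longrightarrow> N (Suc j) * t (Suc i) = t (Suc i) * N (Suc j)"
    and N_comm_d: "i < j \<Longrightarrow> N (Suc j) * d (Suc i) = d (Suc i) * N (Suc j)"
begin

lemma prod_up_comm:
  assumes "x * a = a * x" "\<And>i. i < m \<Longrightarrow> t (Suc i) * a = a * t (Suc i)"
  shows "prod_up t x m * a = a * prod_up t x m"
  using assms(2)
proof (induction m)
  case (Suc m)
  have "x * t (Suc m) * a = a * (x * t (Suc m))"
    using assms(1) Suc.prems[of m] by (metis lessI mult.assoc)
  then have "prod_up t x (Suc m) * a = prod_up t x m * a * (1 + x * t (Suc m))"
    by (simp add: algebra_simps)
  with Suc show ?case by (simp add: mult.assoc)
qed simp

lemma prod_down_comm:
  assumes "z * a = a * z" "\<And>i. i < m \<Longrightarrow> d (Suc i) * a = a * d (Suc i)"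
  shows "prod_down d z m * a = a * prod_down d z m"
  using assms(2)
proof (induction m)
  case (Suc m)
  have *: "z * d (Suc m) * a = a * (z * d (Suc m))"
    using assms(1) Suc.prems[of m] by (metis lessI mult.assoc)
  have "prod_down d z (Suc m) * a = (1 + z * d (Suc m)) * (a * prod_down d z m)"
    using Suc by (simp add: mult.assoc)
  also have "\<dots> = a * (1 + z * d (Suc m)) * prod_down d z m"
    by (simp add: algebra_simps flip: *)
  finally show ?case by (simp add: mult.assoc)
qed simp

text \<open>Passing from k to k + 1 factors creates a term with \<open>N (Suc k)\<close> and one
  with \<open>- N k\<close>. The latter cancels the error of the previous stage, so that only the
  newest error survives.\<close>

lemma prod_up_down:
  assumes x: "\<And>a. x * a = a * x" and z: "\<And>a. z * a = a * z"
  shows "prod_up t x (Suc m) * prod_down d z (Suc m) =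
    prod_down d z (Suc m) * prod_up t x (Suc m) +
    x * z * (prod_up t x m * prod_down d z m * N (Suc m))"
proof -
  define B where "B = prod_up t x"
  define A where "A = prod_down d z"
  \<comment> \<open>The error after m factors, extended by 0 to the empty products so that the
    induction can start there.\<close>
  define Q where "Q m = (case m of 0 \<Rightarrow> 0 | Suc k \<Rightarrow> B k * A k * N m)" for m
  have B_Suc: "B (Suc k) = B k * (1 + x * t (Suc k))"
    and A_Suc: "A (Suc k) = (1 + z * d (Suc k)) * A k" for k
    by (simp_all add: A_def B_def)
  have xz: "x * z * a = a * (x * z)" for a by (metis mult.assoc x z)
  have B_N: "B k * N (Suc k) = N (Suc k) * B k" and A_N: "A k * N (Suc k) = N (Suc k) * A k" for k
    unfolding A_def B_def by (simp_all add: prod_up_comm prod_down_comm x z N_comm_t N_comm_d)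
  have B_d: "B k * d (Suc k) = d (Suc k) * B k" for k
    unfolding B_def by (rule prod_up_comm) (auto simp: x comm)
  have A_t: "A k * t (Suc k) = t (Suc k) * A k" for k
    unfolding A_def by (rule prod_down_comm) (auto simp: z comm)
  \<comment> \<open>The old error, enclosed by the new factors. \<open>N k\<close> annihilates both
    letters of column k + 1 on the left-hand side, and the letters of column k next to it on the
    right-hand side, so all four factors act as 1.\<close>
  have key: "(1 + z * d (Suc k)) * Q k * (1 + x * t (Suc k)) = B k * N k * A k" for k
  proof (cases k)
    case 0 then show ?thesis by (simp add: Q_def N_0)
  next
    case (Suc l)
    have "N k * (1 + x * t (Suc k)) = N k + x * (N k * t (Suc k))"
      by (simp add: distrib_left) (metis mult.assoc x)
    then have 1: "Q k * (1 + x * t (Suc k)) = Q k"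
      by (simp add: Q_def Suc mult.assoc N_t)
    have "Q k = N k * (B l * A l)"
      by (simp add: Q_def Suc mult.assoc A_N) (metis B_N mult.assoc)
    then have "d (Suc k) * Q k = 0"
      by (metis d_N mult.assoc mult_zero_left)
    then have 2: "(1 + z * d (Suc k)) * Q k = Q k"
      by (simp add: algebra_simps)
    have 3: "(1 + x * t (Suc l)) * N (Suc l) = N (Suc l)"
      by (simp add: distrib_right mult.assoc t_N)
    have 4: "N (Suc l) * (1 + z * d (Suc l)) = N (Suc l)"
      by (simp add: distrib_left) (metis N_d mult.assoc mult_zero_right z)
    have "B k * N k * A k = B l * ((1 + x * t (Suc l)) * N (Suc l)) * (1 + z * d (Suc l)) * A l"
      by (simp add: Suc B_Suc A_Suc mult.assoc)
    also have "\<dots> = B l * N (Suc l) * A l"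
      using 4 by (simp only: 3) (simp add: mult.assoc)
    also have "\<dots> = Q k"
      by (simp add: Q_def Suc mult.assoc A_N)
    finally show ?thesis by (simp add: 1 2)
  qed
  have "B k * A k = A k * B k + x * z * Q k" for k
  proof (induction k)
    case 0 then show ?case by (simp add: A_def B_def Q_def)
  next
    case (Suc k)
    let ?t = "t (Suc k)" and ?d = "d (Suc k)"
    have swap: "(1 + x * ?t) * (1 + z * ?d) =
        (1 + z * ?d) * (1 + x * ?t) + x * z * N (Suc k) - x * z * N k"
    proof -
      have "x * ?t * (z * ?d) = x * z * (?t * ?d)" by (metis mult.assoc z)
      moreover have "z * ?d * (x * ?t) = x * z * (?d * ?t)" by (metis mult.assoc x)
      ultimately show ?thesis by (simp add: algebra_simps comm_same)
    qed
    have "B (Suc k) * A (Suc k) = B k * ((1 + x * ?t) * (1 + z * ?d)) * A k"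
      by (simp add: B_Suc A_Suc mult.assoc)
    also have "\<dots> = B k * (1 + z * ?d) * ((1 + x * ?t) * A k) +
        B k * (x * z * N (Suc k)) * A k - B k * (x * z * N k) * A k"
      unfolding swap by (simp add: algebra_simps)
    also have "B k * (1 + z * ?d) = (1 + z * ?d) * B k"
      by (simp add: distrib_left distrib_right) (metis B_d mult.assoc z)
    also have "(1 + x * ?t) * A k = A k * (1 + x * ?t)"
      by (simp add: distrib_left distrib_right) (metis A_t mult.assoc x)
    also have "B k * (x * z * N (Suc k)) * A k = x * z * Q (Suc k)"
      by (simp add: Q_def) (metis A_N mult.assoc xz)
    also have "B k * (x * z * N k) * A k = x * z * (B k * N k * A k)"
      by (metis mult.assoc xz)
    also have "(1 + z * ?d) * B k * (A k * (1 + x * ?t)) =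
        (1 + z * ?d) * (A k * B k + x * z * Q k) * (1 + x * ?t)"
      unfolding Suc[symmetric] by (simp only: mult.assoc)
    also have "\<dots> = A (Suc k) * B (Suc k) + (1 + z * ?d) * (x * z * Q k) * (1 + x * ?t)"
      by (simp add: A_Suc B_Suc distrib_left distrib_right mult.assoc)
    also have "(1 + z * ?d) * (x * z * Q k) * (1 + x * ?t) = x * z * (B k * N k * A k)"
      unfolding key[symmetric] by (metis mult.assoc xz)
    finally show ?case by (simp add: algebra_simps)
  qed
  from this[of "Suc m"] show ?thesis by (simp add: A_def B_def Q_def)
qed

end

section \<open>Operators on functions\<close>

text \<open>Additivity makes composition distribute on both sides, and the ring structure supplies
  the integers that occur as scalars.\<close>

typedef 'a operator =
  "{F :: ('a \<Rightarrow> complex) \<Rightarrow> 'a \<Rightarrow> complex. \<forall>f g. F (\<lambda>x. f x + g x) = (\<lambda>x. F f x + F g x)}"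
  morphisms app Abs_operator
  by (rule exI[of _ "\<lambda>f. f"]) simp

setup_lifting type_definition_operator

lemma operator_eqI: "(\<And>f x. app F f x = app G f x) \<Longrightarrow> F = G"
  by (auto simp: app_inject[symmetric] fun_eq_iff)

lemma app_add: "app F (\<lambda>x. f x + g x) x = app F f x + app F g x"
  using app[of F] by (auto dest: fun_cong)

lemma app_zero: "app F (\<lambda>x. 0) x = 0"
  using app_add[of F "\<lambda>x. 0" "\<lambda>x. 0" x] by simp

lemma app_sum: "app F (\<lambda>x. \<Sum>i\<in>I. f i x) x = (\<Sum>i\<in>I. app F (f i) x)"
  by (induction I rule: infinite_finite_induct) (simp_all add: app_zero app_add)

instantiation operator :: (type) ring_1
begin

lift_definition zero_operator :: "'a operator" is "\<lambda>f x. 0" by simp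
lift_definition one_operator :: "'a operator" is "\<lambda>f x. f x" by simp
lift_definition plus_operator :: "'a operator \<Rightarrow> 'a operator \<Rightarrow> 'a operator"
  is "\<lambda>F G f x. F f x + G f x" by (simp add: fun_eq_iff)
lift_definition minus_operator :: "'a operator \<Rightarrow> 'a operator \<Rightarrow> 'a operator"
  is "\<lambda>F G f x. F f x - G f x" by (simp add: fun_eq_iff)
lift_definition uminus_operator :: "'a operator \<Rightarrow> 'a operator"
  is "\<lambda>F f x. - F f x" by (simp add: fun_eq_iff)
lift_definition times_operator :: "'a operator \<Rightarrow> 'a operator \<Rightarrow> 'a operator"
  is "\<lambda>F G f. F (G f)" by simp

instance
proof
  fix F G H :: "'a operator"
  show "F + G + H = F + (G + H)" by transfer (simp add: algebra_simps)
  show "F + G = G + F" by transfer (simp add: algebra_simps)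
  show "0 + F = F" by transfer simp
  show "- F + F = 0" by transfer simp
  show "F - G = F + - G" by transfer simp
  show "F * G * H = F * (G * H)" by transfer simp
  show "1 * F = F" by transfer simp
  show "F * 1 = F" by transfer simp
  show "(F + G) * H = F * H + G * H" by transfer simp
  show "F * (G + H) = F * G + F * H" by transfer simp
  show "(0 :: 'a operator) \<noteq> 1" by transfer (metis zero_neq_one)
qed

end

lemma app_simps [simp]:
  "app 0 f x = 0" "app 1 f x = f x"
  "app (F + G) f x = app F f x + app G f x"
  "app (F - G) f x = app F f x - app G f x"
  "app (- F) f x = - app F f x"
  "app (F * G) f = app F (app G f)"
  by (simp_all add: zero_operator.rep_eq one_operator.rep_eq plus_operator.rep_eq
      minus_operator.rep_eq uminus_operator.rep_eq times_operator.rep_eq)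

lemma app_sum_left: "app (\<Sum>i\<in>I. F i) f x = (\<Sum>i\<in>I. app (F i) f x)"
  by (induction I rule: infinite_finite_induct) simp_all

lemma app_of_nat_mult: "app (of_nat n * F) f x = of_nat n * app F f x"
  by (induction n) (simp_all add: algebra_simps)

section \<open>Sums over words of partial maps\<close>

definition act :: "(nat \<Rightarrow> 'a \<Rightarrow> 'a option) \<Rightarrow> nat list \<Rightarrow> 'a \<Rightarrow> 'a option"
  where "act p w x = foldr (\<lambda>i r. Option.bind r (p i)) w (Some x)"

lemma act_Nil [simp]: "act p [] x = Some x"
  by (simp add: act_def)

lemma act_Cons: "act p (i # w) x = Option.bind (act p w x) (p i)"
  by (simp add: act_def)

lemma act_append: "act p (u @ v) x = Option.bind (act p v x) (act p u)"
  by (induction u) (cases "act p v x"; simp add: act_Cons)+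

text \<open>Functions are pulled back along the maps, hence the order of factors is reversed: a
  concatenation \<open>u @ v\<close> becomes the product of the operator of \<open>v\<close> with that of \<open>u\<close>.\<close>

lift_definition word_op :: "(nat \<Rightarrow> 'a \<Rightarrow> 'a option) \<Rightarrow> nat list set \<Rightarrow> 'a operator"
  is "\<lambda>p W f x. \<Sum>w | w \<in> W \<and> act p w x \<noteq> None. f (the (act p w x))"
  by (simp add: sum.distrib)

text \<open>A sum over an infinite set is 0 by convention, so the rules for unions and
  concatenations ask for finitely many applicable words at every point.\<close>

definition locally_finite :: "(nat \<Rightarrow> 'a \<Rightarrow> 'a option) \<Rightarrow> nat list set \<Rightarrow> bool"
  where "locally_finite p W \<longleftrightarrow> (\<forall>x. finite {w \<in> W. act p w x \<noteq> None})"

lemma finite_locally_finite: "finite W \<Longrightarrow> locally_finite p W"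
  by (simp add: locally_finite_def)

lemma word_op_empty [simp]: "word_op p {} = 0"
  by transfer simp

lemma app_word_op_singleton:
  "app (word_op p {w}) f x = (case act p w x of None \<Rightarrow> 0 | Some y \<Rightarrow> f y)"
proof -
  have "{v. v \<in> {w} \<and> act p v x \<noteq> None} = (if act p w x = None then {} else {w})"
    by auto
  then show ?thesis by (auto simp: word_op.rep_eq split: option.splits)
qed

lemma word_op_Nil [simp]: "word_op p {[]} = 1"
  by (rule operator_eqI) (simp add: app_word_op_singleton)

lemma word_op_Un:
  assumes "locally_finite p U" "locally_finite p V" "U \<inter> V = {}"
  shows "word_op p (U \<union> V) = word_op p U + word_op p V"
proof (rule operator_eqI)
  fix f x
  have "{w. w \<in> U \<union> V \<and> act p w x \<noteq> None} =
      {w. w \<in> U \<and> act p w x \<noteq> None} \<union> {w. w \<in> V \<and> act p w x \<noteq> None}" by auto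
  then show "app (word_op p (U \<union> V)) f x = app (word_op p U + word_op p V) f x"
    using assms by (auto simp: word_op.rep_eq locally_finite_def intro!: sum.union_disjoint)
qed

text \<open>A word with two factorizations would be counted once on the left and twice on the right;
  \<open>inj\<close> excludes this.\<close>

lemma word_op_append:
  assumes U: "locally_finite p U" and V: "locally_finite p V"
    and inj: "inj_on (\<lambda>(u, v). u @ v) (U \<times> V)"
  shows "word_op p ((\<lambda>(u, v). u @ v) ` (U \<times> V)) = word_op p V * word_op p U"
proof (rule operator_eqI)
  fix f x
  let ?S = "\<lambda>W x. {w. w \<in> W \<and> act p w x \<noteq> None}"
  let ?P = "SIGMA v : ?S V x. ?S U (the (act p v x))"
  have "app (word_op p V * word_op p U) f x =
      (\<Sum>v\<in>?S V x. \<Sum>u\<in>?S U (the (act p v x)). f (the (act p u (the (act p v x)))))"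
    by (simp add: word_op.rep_eq)
  also have "\<dots> = (\<Sum>(v, u)\<in>?P. f (the (act p u (the (act p v x)))))"
    using U V by (intro sum.Sigma) (auto simp: locally_finite_def)
  also have "\<dots> = (\<Sum>w\<in>?P. f (the (act p (case w of (v, u) \<Rightarrow> u @ v) x)))"
    by (auto simp: act_append intro!: sum.cong)
  also have "\<dots> = (\<Sum>w\<in>?S ((\<lambda>(u, v). u @ v) ` (U \<times> V)) x. f (the (act p w x)))"
  proof (rule sum.reindex_bij_betw, rule bij_betw_imageI)
    show "inj_on (\<lambda>(v, u). u @ v) ?P"
      using inj by (auto simp: inj_on_def)
    show "(\<lambda>(v, u). u @ v) ` ?P = ?S ((\<lambda>(u, v). u @ v) ` (U \<times> V)) x"
      by (force simp: act_append image_iff bind_eq_Some_conv)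
  qed
  finally show "app (word_op p ((\<lambda>(u, v). u @ v) ` (U \<times> V))) f x =
      app (word_op p V * word_op p U) f x"
    by (simp add: word_op.rep_eq)
qed

lemma word_op_Cons:
  assumes "locally_finite p W"
  shows "word_op p ((#) i ` W) = word_op p W * word_op p {[i]}"
proof -
  have "(#) i ` W = (\<lambda>(u, v). u @ v) ` ({[i]} \<times> W)" by (auto simp: image_iff)
  then show ?thesis
    using assms by (simp add: word_op_append finite_locally_finite inj_on_def)
qed

lemma word_op_snoc:
  assumes "locally_finite p W"
  shows "word_op p ((\<lambda>w. w @ [i]) ` W) = word_op p {[i]} * word_op p W"
proof -
  have "(\<lambda>w. w @ [i]) ` W = (\<lambda>(u, v). u @ v) ` (W \<times> {[i]})" by force
  then show ?thesis
    using assms by (simp add: word_op_append finite_locally_finite inj_on_def)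
qed

lemma word_op_cong:
  assumes "\<And>w y. w \<in> W \<Longrightarrow> act p w x = Some y \<Longrightarrow> f y = g y"
  shows "app (word_op p W) f x = app (word_op p W) g x"
  using assms by (auto simp: word_op.rep_eq intro!: sum.cong)

lemma word_op_restrict:
  assumes "\<And>w y. act p w x = Some y \<Longrightarrow> w \<in> U \<longleftrightarrow> w \<in> V"
  shows "app (word_op p U) f x = app (word_op p V) f x"
proof -
  have "{w. w \<in> U \<and> act p w x \<noteq> None} = {w. w \<in> V \<and> act p w x \<noteq> None}" using assms by auto
  then show ?thesis by (simp add: word_op.rep_eq)
qed

section \<open>Monotone words and their generating products\<close>

definition sorted_words :: "(nat \<Rightarrow> nat \<Rightarrow> bool) \<Rightarrow> nat \<Rightarrow> nat list set"
  where "sorted_words R k = {w. length w = k \<and> 0 \<notin> set w \<and> sorted_wrt R w}"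

definition bounded_words :: "(nat \<Rightarrow> nat \<Rightarrow> bool) \<Rightarrow> nat \<Rightarrow> nat \<Rightarrow> nat list set"
  where "bounded_words R m k = {w \<in> sorted_words R k. set w \<subseteq> {..m}}"

lemma finite_bounded_words: "finite (bounded_words R m k)"
proof -
  have "bounded_words R m k \<subseteq> {w. set w \<subseteq> {..m} \<and> length w = k}"
    by (auto simp: bounded_words_def sorted_words_def)
  then show ?thesis using finite_lists_length_eq finite_subset by blast
qed

lemma lf_bounded_words [simp]: "locally_finite p (bounded_words R m k)"
  by (simp add: finite_locally_finite finite_bounded_words)

lemma sorted_words_0 [simp]: "sorted_words R 0 = {[]}"
  by (auto simp: sorted_words_def)

lemma bounded_words_0 [simp]: "bounded_words R m 0 = {[]}"
  by (auto simp: bounded_words_def)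

lemma bounded_words_0_Suc [simp]: "bounded_words R 0 (Suc k) = {}"
  by (auto simp: bounded_words_def sorted_words_def length_Suc_conv)

lemma bounded_words_less:
  "bounded_words (<) (Suc m) (Suc k) =
    bounded_words (<) m (Suc k) \<union> (\<lambda>w. w @ [Suc m]) ` bounded_words (<) m k"
proof (intro equalityI subsetI)
  fix w assume w: "w \<in> bounded_words (<) (Suc m) (Suc k)"
  then have "w \<noteq> []" by (auto simp: bounded_words_def sorted_words_def)
  then obtain v a where v: "w = v @ [a]" by (metis rev_exhaust)
  show "w \<in> bounded_words (<) m (Suc k) \<union> (\<lambda>w. w @ [Suc m]) ` bounded_words (<) m k"
    using w unfolding v by (cases "a = Suc m")
      (force simp: bounded_words_def sorted_words_def sorted_wrt_append)+
qed (force simp: bounded_words_def sorted_words_def sorted_wrt_append)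

lemma bounded_words_greater:
  "bounded_words (>) (Suc m) (Suc k) =
    bounded_words (>) m (Suc k) \<union> (#) (Suc m) ` bounded_words (>) m k"
proof (intro equalityI subsetI)
  fix w assume w: "w \<in> bounded_words (>) (Suc m) (Suc k)"
  then obtain v a where v: "w = a # v"
    by (auto simp: bounded_words_def sorted_words_def length_Suc_conv)
  show "w \<in> bounded_words (>) m (Suc k) \<union> (#) (Suc m) ` bounded_words (>) m k"
    using w unfolding v by (cases "a = Suc m")
      (force simp: bounded_words_def sorted_words_def)+
qed (force simp: bounded_words_def sorted_words_def)

text \<open>A word with the largest letter starts with it and may repeat it, so the bound for the
  rest stays \<open>Suc m\<close>, unlike in the strict cases. This is the recursion of a geometric
  series.\<close>

lemma bounded_words_ge:
  "bounded_words (\<ge>) (Suc m) (Suc k) =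
    bounded_words (\<ge>) m (Suc k) \<union> (#) (Suc m) ` bounded_words (\<ge>) (Suc m) k"
proof (intro equalityI subsetI)
  fix w assume w: "w \<in> bounded_words (\<ge>) (Suc m) (Suc k)"
  then obtain v a where v: "w = a # v"
    by (auto simp: bounded_words_def sorted_words_def length_Suc_conv)
  show "w \<in> bounded_words (\<ge>) m (Suc k) \<union> (#) (Suc m) ` bounded_words (\<ge>) (Suc m) k"
    using w unfolding v by (cases "a = Suc m")
      (force simp: bounded_words_def sorted_words_def)+
qed (force simp: bounded_words_def sorted_words_def)

lemma word_op_less_Suc:
  "word_op p (bounded_words (<) (Suc m) (Suc k)) = word_op p (bounded_words (<) m (Suc k)) +
    word_op p {[Suc m]} * word_op p (bounded_words (<) m k)"
  unfolding bounded_words_less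
  by (subst word_op_Un)
     (auto simp: word_op_snoc finite_locally_finite finite_bounded_words, auto simp: bounded_words_def)

lemma word_op_greater_Suc:
  "word_op p (bounded_words (>) (Suc m) (Suc k)) = word_op p (bounded_words (>) m (Suc k)) +
    word_op p (bounded_words (>) m k) * word_op p {[Suc m]}"
  unfolding bounded_words_greater
  by (subst word_op_Un)
     (auto simp: word_op_Cons finite_locally_finite finite_bounded_words, auto simp: bounded_words_def)

lemma word_op_ge_Suc:
  "word_op p (bounded_words (\<ge>) (Suc m) (Suc k)) = word_op p (bounded_words (\<ge>) m (Suc k)) +
    word_op p (bounded_words (\<ge>) (Suc m) k) * word_op p {[Suc m]}"
  unfolding bounded_words_ge
  by (subst word_op_Un)
     (auto simp: word_op_Cons finite_locally_finite finite_bounded_words, auto simp: bounded_words_def)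

lemma mult_fps_X_left: "f * (fps_X * g) = fps_X * (f * g)" for f g :: "'a::ring_1 fps"
  by (metis fps_mult_fps_X_commute mult.assoc)

text \<open>The factor of the new column stands on the left, so under pull-back its letter acts
  first and comes last in the word: the words increase.\<close>

lemma prod_down_nth:
  "prod_down (\<lambda>i. fps_const (word_op p {[i]})) fps_X m $ k = word_op p (bounded_words (<) m k)"
proof (induction m arbitrary: k)
  case 0 then show ?case by (cases k) simp_all
next
  case (Suc m)
  then show ?case by (cases k) (simp_all add: distrib_right mult.assoc word_op_less_Suc)
qed

lemma prod_up_nth:
  "prod_up (\<lambda>i. fps_const (word_op p {[i]})) fps_X m $ k = word_op p (bounded_words (>) m k)"
proof (induction m arbitrary: k)
  case 0 then show ?case by (cases k) simp_all
next
  case (Suc m)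
  then show ?case
    by (cases k) (simp_all add: distrib_left mult_fps_X_left word_op_greater_Suc)
qed

text \<open>A noncommutative form of the relation between complete and elementary symmetric
  functions. The first series is an ordered product of geometric series, the second the product of
  their inverses in the opposite order, so the factors of the largest column meet in the middle and
  cancel.\<close>

lemma vertical_horizontal_bounded:
  "Abs_fps (\<lambda>k. word_op p (bounded_words (\<ge>) m k)) *
    Abs_fps (\<lambda>k. (- 1) ^ k * word_op p (bounded_words (<) m k)) = 1"
proof (induction m)
  case 0
  have "Abs_fps (\<lambda>k. word_op p (bounded_words (\<ge>) 0 k)) = 1"
    and "Abs_fps (\<lambda>k. (- 1) ^ k * word_op p (bounded_words (<) 0 k)) = 1"
    by (auto simp: fps_eq_iff gr0_conv_Suc)
  then show ?case by simp
next
  case (Suc m)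
  let ?V = "\<lambda>m. Abs_fps (\<lambda>k. word_op p (bounded_words (\<ge>) m k))"
  let ?A = "\<lambda>m. Abs_fps (\<lambda>k. (- 1) ^ k * word_op p (bounded_words (<) m k))"
  let ?d = "1 - fps_X * fps_const (word_op p {[Suc m]})"
  have "?A (Suc m) $ k = (?d * ?A m) $ k" for k
    by (cases k) (simp_all add: left_diff_distrib mult.assoc word_op_less_Suc distrib_left
        minus_one_power_iff)
  then have A: "?A (Suc m) = ?d * ?A m" by (simp add: fps_eq_iff)
  have "(?V (Suc m) * ?d) $ k = ?V m $ k" for k
    by (cases k) (simp_all add: right_diff_distrib mult_fps_X_left word_op_ge_Suc)
  then have V: "?V (Suc m) * ?d = ?V m" by (simp add: fps_eq_iff)
  have "?V (Suc m) * ?A (Suc m) = ?V (Suc m) * ?d * ?A m" unfolding A by (simp only: mult.assoc)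
  with V Suc show ?case by simp
qed

section \<open>Adding and removing boxes\<close>

lemma add_box_1 [simp]: "add_box (Suc 0) \<alpha> = Some (1 # \<alpha>)"
  by (simp add: add_box_def)

lemma add_box_0 [simp]: "add_box 0 \<alpha> = None"
  by (simp add: add_box_def)

lemma add_box_Nil [simp]: "add_box (Suc (Suc i)) [] = None"
  by (simp add: add_box_def)

lemma add_box_Cons [simp]:
  "add_box (Suc (Suc i)) (x # xs) =
    (if x = Suc i then Some (Suc (Suc i) # xs) else map_option ((#) x) (add_box (Suc (Suc i)) xs))"
proof (cases "x = Suc i")
  case True
  then have "(LEAST k. k < length (x # xs) \<and> (x # xs) ! k = Suc i) = 0"
    by (intro Least_equality) auto
  with True show ?thesis by (simp add: add_box_def)
next
  case False
  show ?thesis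
  proof (cases "Suc i \<in> set xs")
    case True
    then obtain k where k: "k < length xs" "xs ! k = Suc i" by (auto simp: in_set_conv_nth)
    have "(LEAST k. k < length (x # xs) \<and> (x # xs) ! k = Suc i) =
        Suc (LEAST k. Suc k < length (x # xs) \<and> (x # xs) ! Suc k = Suc i)"
      by (rule Least_Suc[of _ "Suc k"]) (use k False in auto)
    with True False show ?thesis by (simp add: add_box_def)
  qed (use False in \<open>simp add: add_box_def\<close>)
qed

lemma add_box_eq_None: "add_box (Suc (Suc i)) xs = None \<longleftrightarrow> Suc i \<notin> set xs"
  by (simp add: add_box_def)

lemma rem_box_eq_None: "rem_box i xs = None \<longleftrightarrow> i \<notin> set xs"
  by (simp add: rem_box_def)

lemma rem_box_Nil [simp]: "rem_box i [] = None"
  by (simp add: rem_box_def)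

text \<open>The rightmost part is changed, so the tail has priority over the head;
  \<open>add_box\<close> has the opposite preference. These recursions replace positions given by
  \<open>GREATEST\<close> and \<open>LEAST\<close>.\<close>

lemma rem_box_Cons:
  "rem_box i (x # xs) = (case rem_box i xs of Some ys \<Rightarrow> Some (x # ys)
    | None \<Rightarrow> if x = i then Some ((i - 1) # xs) else None)"
proof (cases "i \<in> set xs")
  case True
  let ?P = "\<lambda>k. k < length xs \<and> xs ! k = i"
  have "\<exists>k. ?P k" using True by (auto simp: in_set_conv_nth)
  then have P: "?P (Greatest ?P)"
    by (rule GreatestI_ex_nat[where b = "length xs"]) auto
  have "k \<le> Suc (Greatest ?P)" if "k < length (x # xs) \<and> (x # xs) ! k = i" for k
  proof (cases k)
    case (Suc l)
    with that have "l \<le> Greatest ?P"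
      by (intro Greatest_le_nat[where b = "length xs"]) auto
    with Suc show ?thesis by simp
  qed simp
  with P have "(GREATEST k. k < length (x # xs) \<and> (x # xs) ! k = i) = Suc (Greatest ?P)"
    by (intro Greatest_equality) auto
  with True show ?thesis by (simp add: rem_box_def)
next
  case False
  show ?thesis
  proof (cases "x = i")
    case True
    have "k = 0" if "k < length (x # xs) \<and> (x # xs) ! k = i" for k
      using that False by (cases k) auto
    with True have "(GREATEST k. k < length (x # xs) \<and> (x # xs) ! k = i) = 0"
      by (intro Greatest_equality) auto
    with True False show ?thesis by (simp add: rem_box_def)
  qed (use False in \<open>simp add: rem_box_def\<close>)
qed

text \<open>In contrast to \<^const>\<open>rem_box\<close> followed by \<^const>\<open>drop_zeros\<close>, this keeps the zeros that were
  present before, so that the commutation relations hold for arbitrary lists.\<close>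

fun rem_part :: "nat \<Rightarrow> nat list \<Rightarrow> nat list option" where
  "rem_part i [] = None"
| "rem_part i (x # xs) = (case rem_part i xs of Some ys \<Rightarrow> Some (x # ys)
    | None \<Rightarrow> if x = i then Some (if i = 1 then xs else (i - 1) # xs) else None)"

lemma rem_part_eq_None: "rem_part i xs = None \<longleftrightarrow> i \<notin> set xs"
  by (induction xs) (auto split: option.splits)

text \<open>Letters are positive, so zeros are never touched and deleting them does not affect which
  part is the rightmost one. Only a part 1 that becomes 0 has to vanish, which is the case
  \<open>i = 1\<close> of \<open>rem_part\<close>.\<close>

lemma drop_zeros_rem_box:
  "0 < i \<Longrightarrow> map_option drop_zeros (rem_box i xs) = rem_part i (drop_zeros xs)"
proof (induction xs)
  case (Cons x xs)
  have "rem_box i xs = None \<longleftrightarrow> rem_part i (drop_zeros xs) = None"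
    using Cons.prems by (simp add: rem_box_eq_None rem_part_eq_None drop_zeros_def)
  with Cons show ?case
    by (auto simp: rem_box_Cons drop_zeros_def split: option.splits)
qed (simp add: drop_zeros_def)

lemma drop_zeros_rem_boxes:
  "0 \<notin> set w \<Longrightarrow> map_option drop_zeros (rem_boxes w \<alpha>) = act rem_part w (drop_zeros \<alpha>)"
proof (induction w)
  case (Cons i w)
  have "rem_boxes (i # w) \<alpha> = Option.bind (rem_boxes w \<alpha>) (rem_box i)"
    by (simp add: rem_boxes_def)
  moreover have "act rem_part w (drop_zeros \<alpha>) = map_option drop_zeros (rem_boxes w \<alpha>)"
    using Cons by simp
  ultimately show ?case
    using Cons.prems by (cases "rem_boxes w \<alpha>") (simp_all add: act_Cons drop_zeros_rem_box)
qed (simp add: rem_boxes_def)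

lemma drop_zeros_composition: "is_composition \<alpha> \<Longrightarrow> drop_zeros \<alpha> = \<alpha>"
  unfolding drop_zeros_def is_composition_def by (rule filter_True) auto

lemma rem_part_size: "rem_part i \<alpha> = Some \<gamma> \<Longrightarrow> 0 < i \<Longrightarrow> sum_list \<alpha> = Suc (sum_list \<gamma>)"
  by (induction \<alpha> arbitrary: \<gamma>) (auto split: option.splits if_splits)

lemma rem_part_composition: "rem_part i \<alpha> = Some \<gamma> \<Longrightarrow> is_composition \<alpha> \<Longrightarrow> is_composition \<gamma>"
  by (induction \<alpha> arbitrary: \<gamma>) (auto simp: is_composition_def split: option.splits if_splits)

lemma add_box_composition: "add_box i \<alpha> = Some \<gamma> \<Longrightarrow> is_composition \<alpha> \<Longrightarrow> is_composition \<gamma>"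
  using covers_c_composition(2)[of \<alpha> \<gamma>] add_box_0[of \<alpha>] unfolding covers_c_def
  by (metis One_nat_def Suc_leI bot_nat_0.not_eq_extremum option.distinct(1))

lemma act_rem_part:
  "act rem_part w \<alpha> = Some \<gamma> \<Longrightarrow> 0 \<notin> set w \<Longrightarrow>
    sum_list \<alpha> = sum_list \<gamma> + length w \<and> (\<forall>i\<in>set w. i \<le> sum_list \<alpha>)
      \<and> (is_composition \<alpha> \<longrightarrow> is_composition \<gamma>)"
proof (induction w arbitrary: \<gamma>)
  case (Cons i w)
  then obtain \<delta> where d: "act rem_part w \<alpha> = Some \<delta>" "rem_part i \<delta> = Some \<gamma>"
    by (auto simp: act_Cons bind_eq_Some_conv)
  have "i \<in> set \<delta>" using d(2) rem_part_eq_None[of i \<delta>] by auto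
  then have "i \<le> sum_list \<delta>" by (simp add: member_le_sum_list)
  with Cons d rem_part_size[OF d(2)] rem_part_composition[OF d(2)] show ?case by fastforce
qed simp

text \<open>The bound on the letters is what makes truncation harmless: no box lies in a column
  beyond the final size.\<close>

lemma act_add_box:
  "act add_box w \<alpha> = Some \<gamma> \<Longrightarrow>
    sum_list \<gamma> = sum_list \<alpha> + length w \<and> (\<forall>i\<in>set w. 0 < i \<and> i \<le> sum_list \<gamma>)
      \<and> (is_composition \<alpha> \<longrightarrow> is_composition \<gamma>)"
proof (induction w arbitrary: \<gamma>)
  case (Cons i w)
  then obtain \<delta> where d: "act add_box w \<alpha> = Some \<delta>" "add_box i \<delta> = Some \<gamma>"
    by (auto simp: act_Cons bind_eq_Some_conv)
  have s: "sum_list \<gamma> = Suc (sum_list \<delta>)" using add_box_size[OF d(2)] .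
  have "0 < i" using d(2) by (cases i) auto
  moreover have "i \<le> sum_list \<gamma>"
  proof (cases "i = 1")
    case False
    then have "i - 1 \<in> set \<delta>" using d(2) by (auto simp: add_box_def split: if_splits)
    then have "i - 1 \<le> sum_list \<delta>" by (simp add: member_le_sum_list)
    with s show ?thesis by simp
  qed (simp add: s)
  ultimately show ?case
    using Cons.IH[OF d(1)] s add_box_composition[OF d(2)] by fastforce
qed simp

section \<open>The commutation relations\<close>

lemma add_box_in_set: "add_box (Suc i) xs = Some ys \<Longrightarrow> Suc i \<in> set ys"
  by (cases i; induction xs arbitrary: ys) (auto split: if_splits)

lemma rem_part_in_set: "rem_part (Suc (Suc i)) xs = Some ys \<Longrightarrow> Suc i \<in> set ys"
  by (induction xs arbitrary: ys) (auto split: if_splits option.splits)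

lemma add_box_mem_other:
  "add_box (Suc i) xs = Some ys \<Longrightarrow> j \<noteq> Suc i \<Longrightarrow> j \<noteq> i \<Longrightarrow> j \<in> set ys \<longleftrightarrow> j \<in> set xs"
  by (cases i; induction xs arbitrary: ys) (auto split: if_splits)

lemma rem_part_mem_other:
  "rem_part (Suc i) xs = Some ys \<Longrightarrow> j \<noteq> Suc i \<Longrightarrow> j \<noteq> i \<Longrightarrow> j \<in> set ys \<longleftrightarrow> j \<in> set xs"
  by (induction xs arbitrary: ys) (auto split: if_splits option.splits)

text \<open>Neither operator produces a part that the other one looks for: adding turns i into i +
  1, removing turns j + 1 into j. They compete only if j + 1 = i, and then they take parts from
  opposite ends; a single part i makes both orders undefined.\<close>

lemma add_box_rem_part_commute:
  assumes "i \<noteq> j"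
  shows "Option.bind (add_box (Suc i) xs) (rem_part (Suc j)) =
    Option.bind (rem_part (Suc j) xs) (add_box (Suc i))"
proof (cases i)
  case 0
  with assms show ?thesis by (auto split: option.splits)
next
  case (Suc k)
  show ?thesis
  proof (induction xs)
    case Nil then show ?case by (simp add: Suc)
  next
    case (Cons x xs)
    let ?a = "add_box (Suc i) xs" and ?r = "rem_part (Suc j) xs"
    have a: "?a = None \<longleftrightarrow> i \<notin> set xs" by (simp add: Suc add_box_eq_None)
    have r: "?r = None \<longleftrightarrow> Suc j \<notin> set xs" by (rule rem_part_eq_None)
    have m: "\<forall>ys. ?a = Some ys \<longrightarrow> Suc j = i \<or> (rem_part (Suc j) ys = None \<longleftrightarrow> ?r = None)"
      using add_box_mem_other[of i xs _ "Suc j"] assms by (auto simp: rem_part_eq_None)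
    show ?case
      using Cons assms m a r
      by (cases ?a; cases ?r) (auto simp: Suc split: option.splits if_splits)
  qed
qed

text \<open>The new part i + 1 is the only one, hence the rightmost, and the removal undoes the
  addition.\<close>

lemma rem_part_add_box_id:
  "Suc i \<notin> set xs \<Longrightarrow> i = 0 \<or> i \<in> set xs \<Longrightarrow>
    Option.bind (add_box (Suc i) xs) (rem_part (Suc i)) = Some xs"
proof (cases i)
  case 0
  assume "Suc i \<notin> set xs"
  with 0 show ?thesis using rem_part_eq_None[of 1 xs] by simp
next
  case (Suc k)
  assume "Suc i \<notin> set xs" "i = 0 \<or> i \<in> set xs"
  then show ?thesis
  proof (induction xs)
    case (Cons x xs)
    then show ?case
      using rem_part_eq_None[of "Suc i" xs]
      by (auto simp: Suc bind_eq_Some_conv)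
  qed (simp add: Suc)
qed

lemma add_box_rem_part_id:
  "Suc (Suc i) \<in> set xs \<Longrightarrow> Suc i \<notin> set xs \<Longrightarrow>
    Option.bind (rem_part (Suc (Suc i)) xs) (add_box (Suc (Suc i))) = Some xs"
proof (induction xs)
  case (Cons x xs)
  then show ?case
    using rem_part_eq_None[of "Suc (Suc i)" xs]
    by (auto simp: bind_eq_Some_conv split: option.splits)
qed simp

text \<open>If the leftmost part i stands before the rightmost part i + 1, two different parts
  change independently; a new row, for i = 0, is always in front. Otherwise the part changed first
  becomes the rightmost i + 1, respectively the leftmost i, so the second operator undoes the first
  in either order.\<close>

lemma rem_part_add_box_same:
  "Suc i \<in> set xs \<Longrightarrow> i = 0 \<or> i \<in> set xs \<Longrightarrow>
    Option.bind (add_box (Suc i) xs) (rem_part (Suc i)) =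
    Option.bind (rem_part (Suc i) xs) (add_box (Suc i))"
proof (cases i)
  case 0
  assume "Suc i \<in> set xs"
  then have "rem_part 1 xs \<noteq> None" by (simp add: 0 rem_part_eq_None)
  with 0 show ?thesis by auto
next
  case (Suc k)
  assume "Suc i \<in> set xs" "i = 0 \<or> i \<in> set xs"
  then show ?thesis
  proof (induction xs)
    case (Cons x xs)
    let ?a = "add_box (Suc i) xs" and ?r = "rem_part (Suc i) xs"
    have a: "?a = None \<longleftrightarrow> i \<notin> set xs" by (simp add: Suc add_box_eq_None)
    have r: "?r = None \<longleftrightarrow> Suc i \<notin> set xs" by (rule rem_part_eq_None)
    have m: "rem_part (Suc i) ys \<noteq> None" if "?a = Some ys" for ys
      using add_box_in_set[OF that] by (simp add: rem_part_eq_None)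
    have id: "rem_part (Suc i) ys = Some xs" if "?a = Some ys" "?r = None" for ys
      using rem_part_add_box_id[of i xs] that a r by auto
    have n: "add_box (Suc i) zs \<noteq> None" if "?r = Some zs" for zs
      using rem_part_in_set[of k xs zs] that by (simp add: Suc add_box_eq_None)
    show ?case
      using Cons a r m id n
      by (cases ?a; cases ?r) (auto simp: Suc split: option.splits if_splits)
  qed simp
qed

text \<open>A new row can always be started, as if a part 0 were always present; hence index 0 is
  undefined everywhere and gives the zero projection.\<close>

definition avoiding :: "nat \<Rightarrow> nat list \<Rightarrow> nat list option"
  where "avoiding i \<alpha> = (if i = 0 \<or> i \<in> set \<alpha> then None else Some \<alpha>)"

abbreviation "add_op i \<equiv> word_op add_box {[i]}"
abbreviation "rem_op i \<equiv> word_op rem_part {[i]}"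
abbreviation "avoid_op i \<equiv> word_op avoiding {[i]}"

lemma app_letter: "app (word_op p {[i]}) f x = (case p i x of None \<Rightarrow> 0 | Some y \<Rightarrow> f y)"
  by (simp add: app_word_op_singleton act_Cons)

lemma app_two_letters:
  "app (word_op p {[i]} * word_op q {[j]}) f x =
    (case Option.bind (p i x) (q j) of None \<Rightarrow> 0 | Some y \<Rightarrow> f y)"
  by (auto simp: app_letter split: option.splits bind_splits)

lemma letters_commute:
  assumes "\<And>x. Option.bind (p i x) (q j) = Option.bind (q j x) (p i)"
  shows "word_op p {[i]} * word_op q {[j]} = word_op q {[j]} * word_op p {[i]}"
proof (rule operator_eqI)
  fix f x
  show "app (word_op p {[i]} * word_op q {[j]}) f x = app (word_op q {[j]} * word_op p {[i]}) f x"
    by (simp only: app_two_letters assms)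
qed

lemma letters_mult_0:
  assumes "\<And>x. Option.bind (p i x) (q j) = None"
  shows "word_op p {[i]} * word_op q {[j]} = 0"
proof (rule operator_eqI)
  fix f x
  show "app (word_op p {[i]} * word_op q {[j]}) f x = app 0 f x"
    by (simp only: app_two_letters assms) simp
qed

interpretation boxes: ladder add_op rem_op avoid_op
proof
  fix i j :: nat
  show "add_op (Suc i) * rem_op (Suc j) = rem_op (Suc j) * add_op (Suc i)" if "i \<noteq> j"
    using that by (intro letters_commute add_box_rem_part_commute)
  show "add_op (Suc i) * rem_op (Suc i) = rem_op (Suc i) * add_op (Suc i) + avoid_op (Suc i) - avoid_op i"
  proof (rule operator_eqI)
    fix f x
    show "app (add_op (Suc i) * rem_op (Suc i)) f x =
        app (rem_op (Suc i) * add_op (Suc i) + avoid_op (Suc i) - avoid_op i) f x"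
    \<comment> \<open>If both operators find a part, the two orders agree; if exactly one does, one
      order is the identity and the other undefined; if none does, the two projections
      cancel.\<close>
    proof (cases "Suc i \<in> set x"; cases "i = 0 \<or> i \<in> set x")
      assume "Suc i \<in> set x" "i = 0 \<or> i \<in> set x"
      then show ?thesis
        using rem_part_add_box_same[of i x]
        by (simp only: app_simps(3,4) app_two_letters) (simp add: app_letter avoiding_def)
    next
      assume "Suc i \<in> set x" "\<not> (i = 0 \<or> i \<in> set x)"
      then show ?thesis
        using add_box_rem_part_id[of "i - 1" x] add_box_eq_None[of "i - 1" x]
        by (simp only: app_simps(3,4) app_two_letters) (simp add: app_letter avoiding_def)
    next
      assume "Suc i \<notin> set x" "i = 0 \<or> i \<in> set x"
      then show ?thesis
        using rem_part_add_box_id[of i x] rem_part_eq_None[of "Suc i" x]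
        by (simp only: app_simps(3,4) app_two_letters) (simp add: app_letter avoiding_def)
    next
      assume "Suc i \<notin> set x" "\<not> (i = 0 \<or> i \<in> set x)"
      then show ?thesis
        using add_box_eq_None[of "i - 1" x] rem_part_eq_None[of "Suc i" x]
        by (simp only: app_simps(3,4) app_two_letters) (simp add: app_letter avoiding_def)
    qed
  qed
  show "avoid_op 0 = 0"
    by (rule operator_eqI) (simp add: app_letter avoiding_def)
  show "avoid_op i * add_op (Suc i) = 0"
    by (rule letters_mult_0) (cases i; simp add: avoiding_def add_box_eq_None)
  show "avoid_op (Suc i) * rem_op (Suc i) = 0"
    by (rule letters_mult_0) (simp add: avoiding_def rem_part_eq_None)
  show "add_op (Suc i) * avoid_op (Suc i) = 0"
    by (rule letters_mult_0) (auto simp: avoiding_def dest: add_box_in_set split: bind_splits)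
  show "rem_op (Suc i) * avoid_op i = 0"
    by (rule letters_mult_0) (cases i; auto simp: avoiding_def dest: rem_part_in_set split: bind_splits)
  show "avoid_op (Suc j) * add_op (Suc i) = add_op (Suc i) * avoid_op (Suc j)" if "i < j"
    using that add_box_mem_other[of i _ _ "Suc j"]
    by (intro letters_commute) (fastforce simp: avoiding_def split: bind_splits)
  show "avoid_op (Suc j) * rem_op (Suc i) = rem_op (Suc i) * avoid_op (Suc j)" if "i < j"
    using that rem_part_mem_other[of i _ _ "Suc j"]
    by (intro letters_commute) (fastforce simp: avoiding_def split: bind_splits)
qed

section \<open>Transfer to power series and removal of the truncation\<close>

lemma (in ladder) ladder_fps:
  "ladder (\<lambda>i. fps_const (t i)) (\<lambda>i. fps_const (d i)) (\<lambda>i. fps_const (N i))"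
  by unfold_locales
    (simp_all add: comm comm_same N_0 N_t N_d t_N d_N N_comm_t N_comm_d)

lemma prod_up_fps_const:
  "prod_up (\<lambda>i. fps_const (fps_const (t i))) fps_X m $ k =
    fps_const (prod_up (\<lambda>i. fps_const (t i)) fps_X m $ k)"
proof (induction m arbitrary: k)
  case (Suc m)
  then show ?case by (cases k) (simp_all add: distrib_left mult_fps_X_left)
qed simp

lemma prod_down_fps_const:
  "prod_down (\<lambda>i. fps_const (d i)) (fps_const z) m = fps_const (prod_down d z m)"
  by (induction m) (simp_all flip: fps_const_1_eq_1)

text \<open>In \<open>prod_up_down\<close>, x is the outer variable \<open>fps_X\<close> and z the
  inner one, both central. Coefficients are compared at exponents k + 1 and l + 1; the factor x z
  lowers both by one in the error term.\<close>

lemma bounded_commutation: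
  "word_op add_box (bounded_words (>) (Suc m) (Suc k)) *
      word_op rem_part (bounded_words (<) (Suc m) (Suc l)) =
    word_op rem_part (bounded_words (<) (Suc m) (Suc l)) *
      word_op add_box (bounded_words (>) (Suc m) (Suc k)) +
    word_op add_box (bounded_words (>) m k) * word_op rem_part (bounded_words (<) m l) *
      avoid_op (Suc m)"
proof -
  interpret fps: ladder "\<lambda>i. fps_const (fps_const (add_op i))"
    "\<lambda>i. fps_const (fps_const (rem_op i))" "\<lambda>i. fps_const (fps_const (avoid_op i))"
    by (intro ladder.ladder_fps boxes.ladder_axioms)
  have z: "fps_const fps_X * a = a * fps_const fps_X" for a :: "nat list operator fps fps"
    by (simp add: fps_eq_iff fps_mult_fps_X_commute)
  from arg_cong[OF fps.prod_up_down[where x = fps_X and z = "fps_const fps_X" and m = m,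
        OF fps_mult_fps_X_commute z], of "\<lambda>f. f $ Suc k $ Suc l"]
  show ?thesis
    by (simp add: prod_up_fps_const prod_up_nth prod_down_fps_const prod_down_nth mult.assoc
        del: prod_up.simps prod_down.simps)
qed

text \<open>The coefficient of \<open>x ^ k\<close> in \<open>\<dots> (1 + x t\<^sub>2) (1 + x t\<^sub>1)\<close>: the contribution of one variable
  to \<^const>\<open>skew_schur\<close>, because entries that get equal indices lie in strictly decreasing columns.\<close>

definition row_op :: "nat \<Rightarrow> nat list operator"
  where "row_op k = word_op add_box (sorted_words (>) k)"

definition horizontal_op :: "nat \<Rightarrow> nat list operator"
  where "horizontal_op k = word_op rem_part (sorted_words (<) k)"

definition vertical_op :: "nat \<Rightarrow> nat list operator"
  where "vertical_op k = word_op rem_part (sorted_words (\<ge>) k)"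

lemma add_bounded:
  "sum_list x + k \<le> m \<Longrightarrow>
    app (word_op add_box (sorted_words R k)) f x = app (word_op add_box (bounded_words R m k)) f x"
  by (rule word_op_restrict) (fastforce simp: bounded_words_def sorted_words_def dest: act_add_box)

lemma rem_bounded:
  "sum_list x \<le> m \<Longrightarrow>
    app (word_op rem_part (sorted_words R k)) f x = app (word_op rem_part (bounded_words R m k)) f x"
  by (rule word_op_restrict) (fastforce simp: bounded_words_def sorted_words_def dest: act_rem_part)

lemma bounded_add_cong:
  "(\<And>y. sum_list y = sum_list x + k \<Longrightarrow> f y = g y) \<Longrightarrow>
    app (word_op add_box (bounded_words R m k)) f x = app (word_op add_box (bounded_words R m k)) g x"
  by (rule word_op_cong) (auto simp: bounded_words_def sorted_words_def dest: act_add_box)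

lemma bounded_rem_cong:
  "(\<And>y. sum_list y \<le> sum_list x \<Longrightarrow> f y = g y) \<Longrightarrow>
    app (word_op rem_part (bounded_words R m k)) f x = app (word_op rem_part (bounded_words R m k)) g x"
  by (rule word_op_cong) (auto simp: bounded_words_def sorted_words_def dest: act_rem_part)

lemma row_horizontal:
  "row_op (Suc k) * horizontal_op (Suc l) =
    horizontal_op (Suc l) * row_op (Suc k) + row_op k * horizontal_op l"
proof (rule operator_eqI)
  fix f x
  \<comment> \<open>This bounds every list met after adding k boxes, and \<open>Suc m\<close> does
    so for k + 1 boxes. Lists in the error term have size at most m, hence no part
    \<open>Suc m\<close>, and \<open>avoid_op (Suc m)\<close> acts there as the identity.\<close>
  define m where "m = sum_list x + k"
  let ?T = "\<lambda>m k. word_op add_box (bounded_words (>) m k)"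
  let ?D = "\<lambda>m k. word_op rem_part (bounded_words (<) m k)"
  have TD: "app (row_op j * horizontal_op i) f x = app (?T m' j * ?D m' i) f x"
    if "sum_list x + j \<le> m'" for i j m'
    using that by (auto simp: row_op_def horizontal_op_def add_bounded[of _ _ m'] rem_bounded[of _ m']
        intro!: bounded_add_cong)
  have DT: "app (horizontal_op i * row_op j) f x = app (?D m' i * ?T m' j) f x"
    if "sum_list x + j \<le> m'" for i j m'
    using that by (auto simp: row_op_def horizontal_op_def add_bounded[of _ _ m'] rem_bounded[of _ m']
        intro!: bounded_rem_cong)
  have "app (?T m k * ?D m l * avoid_op (Suc m)) f x = app (?T m k * ?D m l) f x"
  proof -
    have "app (avoid_op (Suc m)) f y = f y" if "sum_list y \<le> m" for y
      using that member_le_sum_list[of "Suc m" y] by (auto simp: app_letter avoiding_def)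
    then show ?thesis
      by (auto simp: m_def intro!: bounded_add_cong bounded_rem_cong)
  qed
  then show "app (row_op (Suc k) * horizontal_op (Suc l)) f x =
      app (horizontal_op (Suc l) * row_op (Suc k) + row_op k * horizontal_op l) f x"
    unfolding app_simps(3) TD[of k m l, unfolded m_def, OF order_refl, folded m_def]
    using TD[of "Suc k" "Suc m" "Suc l"] DT[of "Suc k" "Suc m" "Suc l"]
    by (simp add: bounded_commutation m_def del: app_simps(6))
qed

lemma app_sign: "app ((- 1) ^ n) f x = (- 1) ^ n * f x"
  by (induction n) simp_all

lemma op_0 [simp]: "row_op 0 = 1" "horizontal_op 0 = 1" "vertical_op 0 = 1"
  by (simp_all add: row_op_def horizontal_op_def vertical_op_def)

lemma vertical_horizontal:
  "Abs_fps vertical_op * Abs_fps (\<lambda>k. (- 1) ^ k * horizontal_op k) = 1"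
proof -
  have "app ((Abs_fps vertical_op * Abs_fps (\<lambda>k. (- 1) ^ k * horizontal_op k)) $ n) f x =
      app (1 $ n) f x" for n f x
  proof -
    let ?m = "sum_list x"
    let ?V = "\<lambda>k. word_op rem_part (bounded_words (\<ge>) ?m k)"
    let ?A = "\<lambda>k. (- 1) ^ k * word_op rem_part (bounded_words (<) ?m k)"
    have "app (vertical_op i * ((- 1) ^ j * horizontal_op j)) f x = app (?V i * ?A j) f x" for i j
      by (auto simp: vertical_op_def horizontal_op_def rem_bounded[of _ ?m] 
          app_sign intro!: bounded_rem_cong)
    then have "app ((Abs_fps vertical_op * Abs_fps (\<lambda>k. (- 1) ^ k * horizontal_op k)) $ n) f x =
        app ((Abs_fps ?V * Abs_fps ?A) $ n) f x"
      by (simp add: fps_mult_nth app_sum_left del: app_simps(6))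
    then show ?thesis by (simp only: vertical_horizontal_bounded)
  qed
  then show ?thesis by (intro fps_ext operator_eqI)
qed

text \<open>The ring is not commutative, so the other order needs an argument: a series with
  constant term 1 has a right inverse, and this must equal the left inverse already found.\<close>

lemma horizontal_vertical:
  "Abs_fps (\<lambda>k. (- 1) ^ k * horizontal_op k) * Abs_fps vertical_op = 1"
proof -
  let ?V = "Abs_fps vertical_op" and ?A = "Abs_fps (\<lambda>k. (- 1) ^ k * horizontal_op k)"
  define W where "W = fps_right_inverse ?A 1"
  have AW: "?A * W = 1"
    unfolding W_def by (rule fps_right_inverse) simp
  have "?V = ?V * (?A * W)" by (simp add: AW)
  also have "\<dots> = W" by (simp only: mult.assoc[symmetric] vertical_horizontal mult_1)
  finally show ?thesis using AW by simp
qed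

text \<open>Substituting -z for z is multiplicative; this moves the sign from one strip series to
  the other.\<close>

lemma fps_sign_mult:
  fixes f g :: "'a::ring_1 fps"
  shows "Abs_fps (\<lambda>k. (- 1) ^ k * (f * g) $ k) =
    Abs_fps (\<lambda>k. (- 1) ^ k * f $ k) * Abs_fps (\<lambda>k. (- 1) ^ k * g $ k)"
proof (rule fps_ext)
  fix n
  have "(- 1) ^ n * (f $ i * g $ (n - i)) = (- 1) ^ i * f $ i * ((- 1) ^ (n - i) * g $ (n - i))"
    if "i \<le> n" for i
    using that by (auto simp: minus_one_power_iff)
  then show "Abs_fps (\<lambda>k. (- 1) ^ k * (f * g) $ k) $ n =
    (Abs_fps (\<lambda>k. (- 1) ^ k * f $ k) * Abs_fps (\<lambda>k. (- 1) ^ k * g $ k)) $ n"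
    by (simp add: fps_mult_nth sum_distrib_left)
qed

lemma signed_vertical_horizontal:
  "Abs_fps (\<lambda>k. (- 1) ^ k * vertical_op k) * Abs_fps horizontal_op = 1"
proof -
  have "Abs_fps (\<lambda>k. (- 1) ^ k * vertical_op k) * Abs_fps horizontal_op =
      Abs_fps (\<lambda>k. (- 1) ^ k * (Abs_fps vertical_op * Abs_fps (\<lambda>k. (- 1) ^ k * horizontal_op k)) $ k)"
    unfolding fps_sign_mult by (simp flip: mult.assoc power_add add: mult_2[symmetric])
  also have "\<dots> = 1" unfolding vertical_horizontal by (rule fps_ext) simp
  finally show ?thesis .
qed

text \<open>\<open>row_horizontal\<close> iterated. The sum is the coefficient of x^k in T(x) / (1 -
  x z).\<close>

lemma row_horizontal_fps:
  "fps_const (row_op k) * Abs_fps horizontal_op =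
    Abs_fps horizontal_op * (\<Sum>s\<le>k. fps_const (row_op (k - s)) * fps_X ^ s)"
proof (induction k)
  case (Suc k)
  have "(fps_const (row_op (Suc k)) * Abs_fps horizontal_op) $ l =
      (Abs_fps horizontal_op * fps_const (row_op (Suc k)) +
        fps_X * (fps_const (row_op k) * Abs_fps horizontal_op)) $ l" for l
    by (cases l) (simp_all add: row_horizontal)
  then have "fps_const (row_op (Suc k)) * Abs_fps horizontal_op =
      Abs_fps horizontal_op * fps_const (row_op (Suc k)) +
        fps_X * (fps_const (row_op k) * Abs_fps horizontal_op)" by (rule fps_ext)
  also have "\<dots> = Abs_fps horizontal_op * (fps_const (row_op (Suc k)) +
      (\<Sum>s\<le>k. fps_const (row_op (k - s)) * fps_X ^ s) * fps_X)"
    unfolding Suc by (simp add: distrib_left fps_mult_fps_X_commute mult.assoc)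
  also have "fps_const (row_op (Suc k)) + (\<Sum>s\<le>k. fps_const (row_op (k - s)) * fps_X ^ s) * fps_X =
      (\<Sum>s\<le>Suc k. fps_const (row_op (Suc k - s)) * fps_X ^ s)"
    unfolding sum.atMost_Suc_shift sum_distrib_right by (simp add: mult.assoc power_commutes)
  finally show ?case .
qed simp

text \<open>The relation for the inverse series, multiplied by \<open>Abs_fps vertical_op\<close>
  from both sides. The factor on the right is the coefficient of x^k in (1 + x z) T(x).\<close>

lemma row_vertical_fps:
  "fps_const (row_op k) * Abs_fps vertical_op =
    Abs_fps vertical_op * (fps_const (row_op k) + (if k = 0 then 0 else fps_X * fps_const (row_op (k - 1))))"
proof (cases k)
  case (Suc j)
  let ?V = "Abs_fps vertical_op" and ?A = "Abs_fps (\<lambda>k. (- 1) ^ k * horizontal_op k)"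
  have "(?A * fps_const (row_op (Suc j))) $ l =
      (fps_const (row_op (Suc j)) * ?A + fps_X * (fps_const (row_op j) * ?A)) $ l" for l
  proof (cases l)
    case (Suc i)
    then show ?thesis by (cases "even i") (simp_all add: row_horizontal)
  qed simp
  then have "?A * fps_const (row_op (Suc j)) =
      fps_const (row_op (Suc j)) * ?A + fps_X * (fps_const (row_op j) * ?A)"
    by (rule fps_ext)
  then have "?A * (fps_const (row_op (Suc j)) * ?V) =
      fps_const (row_op (Suc j)) * (?A * ?V) + fps_X * (fps_const (row_op j) * (?A * ?V))"
    by (simp only: distrib_right flip: mult.assoc)
  then have "?V * (?A * (fps_const (row_op (Suc j)) * ?V)) =
      ?V * (fps_const (row_op (Suc j)) + fps_X * fps_const (row_op j))"
    by (simp only: horizontal_vertical mult_1_right)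
  moreover have "?V * (?A * (fps_const (row_op (Suc j)) * ?V)) = fps_const (row_op (Suc j)) * ?V"
    by (simp only: mult.assoc[symmetric] vertical_horizontal mult_1)
  ultimately show ?thesis by (simp add: Suc)
qed simp

section \<open>Several variables\<close>

text \<open>One exponent per variable. The smallest entries belong to the boxes added last, so the
  operator of the first variable stands on the right and acts last.\<close>

fun rows_op :: "nat list \<Rightarrow> nat list operator" where
  "rows_op [] = 1"
| "rows_op (k # ks) = rows_op ks * row_op k"

fun row_words :: "nat list \<Rightarrow> nat list set" where
  "row_words [] = {[]}"
| "row_words (k # ks) = (\<lambda>(u, v). u @ v) ` (sorted_words (>) k \<times> row_words ks)"

lemma length_row_words: "w \<in> row_words ks \<Longrightarrow> length w = sum_list ks"
  by (induction ks arbitrary: w) (auto simp: sorted_words_def)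

lemma locally_finite_add_box:
  assumes "\<And>w. w \<in> W \<Longrightarrow> length w = k"
  shows "locally_finite add_box W"
  unfolding locally_finite_def
proof
  fix x
  have "{w \<in> W. act add_box w x \<noteq> None} \<subseteq> {w. set w \<subseteq> {..sum_list x + k} \<and> length w = k}"
    using assms by (auto dest!: act_add_box)
  then show "finite {w \<in> W. act add_box w x \<noteq> None}"
    using finite_lists_length_eq finite_subset by blast
qed

lemma rows_op_words: "rows_op ks = word_op add_box (row_words ks)"
proof (induction ks)
  case (Cons k ks)
  have "inj_on (\<lambda>(u, v). u @ v) (sorted_words (>) k \<times> row_words ks)"
    by (auto simp: inj_on_def sorted_words_def)
  moreover have "locally_finite add_box (sorted_words (>) k)"
    by (rule locally_finite_add_box[of _ k]) (simp add: sorted_words_def)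
  moreover have "locally_finite add_box (row_words ks)"
    by (rule locally_finite_add_box) (rule length_row_words)
  ultimately show ?case
    by (simp add: Cons row_op_def word_op_append)
qed simp

text \<open>An operator applied to \<open>point \<alpha>\<close> and evaluated at \<beta> is its
  matrix coefficient from \<beta> to \<alpha>.\<close>

abbreviation point :: "'a \<Rightarrow> 'a \<Rightarrow> complex"
  where "point a \<equiv> \<lambda>x. if x = a then 1 else 0"

lemma rows_op_point:
  "app (rows_op ks) (point \<alpha>) \<beta> = of_nat (card {w \<in> row_words ks. act add_box w \<beta> = Some \<alpha>})"
proof -
  have "locally_finite add_box (row_words ks)"
    by (rule locally_finite_add_box) (rule length_row_words)
  then have fin: "finite {w. w \<in> row_words ks \<and> act add_box w \<beta> \<noteq> None}"
    by (simp add: locally_finite_def)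
  have "{w \<in> row_words ks. act add_box w \<beta> = Some \<alpha>} =
      {w. w \<in> row_words ks \<and> act add_box w \<beta> \<noteq> None} \<inter> {w. the (act add_box w \<beta>) = \<alpha>}"
    by auto
  with fin show ?thesis
    by (simp add: rows_op_words word_op.rep_eq sum.If_cases)
qed

text \<open>\<open>c\<close> is 1 on all exponents for the complete and on the exponents 0 and 1 for the elementary
  symmetric functions.\<close>

definition row_fps :: "(nat \<Rightarrow> nat) \<Rightarrow> nat \<Rightarrow> nat list operator fps"
  where "row_fps c k = (\<Sum>s\<le>k. fps_const (of_nat (c s) * row_op (k - s)) * fps_X ^ s)"

fun rows_fps :: "(nat \<Rightarrow> nat) \<Rightarrow> nat list \<Rightarrow> nat list operator fps" where
  "rows_fps c [] = 1"
| "rows_fps c (k # ks) = rows_fps c ks * row_fps c k"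

lemma rows_fps_commute:
  assumes "\<And>k. fps_const (row_op k) * F = F * row_fps c k"
  shows "fps_const (rows_op ks) * F = F * rows_fps c ks"
proof (induction ks)
  case (Cons k ks)
  have "fps_const (rows_op (k # ks)) * F = fps_const (rows_op ks) * (fps_const (row_op k) * F)"
    by (simp flip: mult.assoc)
  also have "\<dots> = fps_const (rows_op ks) * F * row_fps c k"
    by (simp only: assms mult.assoc)
  also have "\<dots> = F * rows_fps c (k # ks)"
    by (simp add: Cons mult.assoc)
  finally show ?case .
qed simp

abbreviation dominated :: "nat list \<Rightarrow> nat list set"
  where "dominated ks \<equiv> {ss. list_all2 (\<le>) ss ks}"

lemma dominated_Cons: "dominated (k # ks) = (\<lambda>(s, ss). s # ss) ` ({..k} \<times> dominated ks)"
  by (auto simp: list_all2_Cons2)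

lemma finite_dominated: "finite (dominated ks)"
proof (induction ks)
  case (Cons k ks)
  then show ?case unfolding dominated_Cons by simp
qed simp

text \<open>\<open>ss\<close> tells how much of each exponent goes to the symmetric function;
  \<open>map2 (-) ks ss\<close> is what remains for the boxes.\<close>

lemma rows_fps_expand:
  "rows_fps c ks = (\<Sum>ss\<in>dominated ks.
    fps_const (of_nat (prod_list (map c ss)) * rows_op (map2 (-) ks ss)) * fps_X ^ sum_list ss)"
proof (induction ks)
  case (Cons k ks)
  let ?g = "\<lambda>ss. fps_const (of_nat (prod_list (map c ss)) * rows_op (map2 (-) ks ss)) * fps_X ^ sum_list ss"
  let ?h = "\<lambda>s. fps_const (of_nat (c s) * row_op (k - s)) * fps_X ^ s"
  have gh: "?g ss * ?h s = fps_const (of_nat (prod_list (map c (s # ss))) *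
      rows_op (map2 (-) (k # ks) (s # ss))) * fps_X ^ sum_list (s # ss)" for s ss
  proof -
    have "?g ss * ?h s = fps_const (of_nat (prod_list (map c ss)) * rows_op (map2 (-) ks ss)) *
        fps_const (of_nat (c s) * row_op (k - s)) * (fps_X ^ sum_list ss * fps_X ^ s)"
      by (metis (no_types, lifting) fps_mult_fps_X_power_commute mult.assoc)
    also have "of_nat (prod_list (map c ss)) * rows_op (map2 (-) ks ss) * (of_nat (c s) * row_op (k - s)) =
        of_nat (prod_list (map c (s # ss))) * (rows_op (map2 (-) ks ss) * row_op (k - s))"
      by (simp add: mult.assoc) (metis (no_types, lifting) mult.assoc mult_of_nat_commute)
    ultimately show ?thesis
      by (simp add: power_add[symmetric] add.commute)
  qed
  have "rows_fps c (k # ks) = (\<Sum>ss\<in>dominated ks. \<Sum>s\<le>k. ?g ss * ?h s)"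
    by (simp add: Cons row_fps_def sum_product)
  also have "\<dots> = (\<Sum>s\<le>k. \<Sum>ss\<in>dominated ks. ?g ss * ?h s)"
    by (rule sum.swap)
  also have "\<dots> = (\<Sum>(s, ss)\<in>{..k} \<times> dominated ks. ?g ss * ?h s)"
    by (rule sum.cartesian_product)
  also have "\<dots> = (\<Sum>ss\<in>dominated (k # ks). fps_const (of_nat (prod_list (map c ss)) *
      rows_op (map2 (-) (k # ks) ss)) * fps_X ^ sum_list ss)"
    unfolding dominated_Cons gh
    by (subst sum.reindex) (simp_all only: comp_def case_prod_unfold, simp add: inj_on_def)
  finally show ?case .
qed simp

lemma rows_fps_nth:
  "rows_fps c ks $ n = (\<Sum>ss\<in>dominated ks. if sum_list ss = n
     then of_nat (prod_list (map c ss)) * rows_op (map2 (-) ks ss) else 0)"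
  unfolding rows_fps_expand fps_sum_nth
  by (rule sum.cong) (auto simp: fps_X_power_mult_right_nth)

section \<open>Strips\<close>

text \<open>A strip removes from column \<open>i\<close> as many boxes as the difference of \<open>parts_ge i\<close>, so its word is
  determined by its two ends.\<close>

definition parts_ge :: "nat \<Rightarrow> nat list \<Rightarrow> nat"
  where "parts_ge i \<alpha> = length (filter (\<lambda>a. i \<le> a) \<alpha>)"

lemma rem_part_parts_ge:
  "rem_part j \<alpha> = Some \<gamma> \<Longrightarrow> 0 < i \<Longrightarrow> 0 < j \<Longrightarrow>
    parts_ge i \<alpha> = parts_ge i \<gamma> + (if i = j then 1 else 0)"
  by (induction \<alpha> arbitrary: \<gamma>) (auto simp: parts_ge_def split: option.splits if_splits)

lemma act_rem_part_parts_ge: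
  "act rem_part w \<alpha> = Some \<gamma> \<Longrightarrow> 0 \<notin> set w \<Longrightarrow> 0 < i \<Longrightarrow>
    parts_ge i \<alpha> = parts_ge i \<gamma> + count_list w i"
  by (induction w arbitrary: \<gamma>) (auto simp: act_Cons bind_eq_Some_conv dest: rem_part_parts_ge)

text \<open>The two ends determine how often each letter occurs, and the monotonicity leaves one
  arrangement of these letters.\<close>

lemma strip_word_unique:
  assumes "u \<in> sorted_words R k" "v \<in> sorted_words R k" "R = (<) \<or> R = (\<ge>)"
    and "act rem_part u \<alpha> = Some \<gamma>" "act rem_part v \<alpha> = Some \<gamma>"
  shows "u = v"
proof -
  have nz: "0 \<notin> set u" "0 \<notin> set v" using assms(1,2) by (auto simp: sorted_words_def)
  have "count_list u i = count_list v i" for i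
  proof (cases "i = 0")
    case True
    then show ?thesis using nz by (simp add: count_list_0_iff)
  next
    case False
    then show ?thesis
      using act_rem_part_parts_ge[OF assms(4) nz(1), of i]
        act_rem_part_parts_ge[OF assms(5) nz(2), of i] by simp
  qed
  then have m: "mset u = mset v" by (intro multiset_eqI) (simp add: count_mset)
  from assms(3) show ?thesis
  proof
    assume "R = (<)"
    then have "sorted u" "sorted v"
      using assms(1,2) by (auto simp: sorted_words_def strict_sorted_iff)
    with m show ?thesis by (metis properties_for_sort)
  next
    assume "R = (\<ge>)"
    then have "sorted (rev u)" "sorted (rev v)"
      using assms(1,2) by (auto simp: sorted_words_def sorted_wrt_rev)
    with m show ?thesis by (metis properties_for_sort mset_rev rev_rev_ident)
  qed
qed

definition strip :: "(nat \<Rightarrow> nat \<Rightarrow> bool) \<Rightarrow> nat \<Rightarrow> nat list \<Rightarrow> nat list \<Rightarrow> bool"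
  where "strip R k \<alpha> \<gamma> \<longleftrightarrow> (\<exists>w\<in>sorted_words R k. act rem_part w \<alpha> = Some \<gamma>)"

lemma strip_rem_boxes:
  assumes "is_composition \<alpha>"
  shows "(\<exists>is \<delta>. length is = k \<and> (\<forall>i\<in>set is. 1 \<le> i) \<and> sorted_wrt R is \<and>
      rem_boxes is \<alpha> = Some \<delta> \<and> \<gamma> = drop_zeros \<delta>) \<longleftrightarrow> strip R k \<alpha> \<gamma>" (is "?L \<longleftrightarrow> ?R")
proof
  assume ?L
  then obtain w \<delta> where w: "length w = k" "\<forall>i\<in>set w. 1 \<le> i" "sorted_wrt R w"
    "rem_boxes w \<alpha> = Some \<delta>" "\<gamma> = drop_zeros \<delta>" by blast
  moreover from w have "0 \<notin> set w" by auto
  ultimately show ?R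
    using drop_zeros_rem_boxes[of w \<alpha>] assms
    by (auto simp: strip_def sorted_words_def drop_zeros_composition intro!: bexI[of _ w])
next
  assume ?R
  then obtain w where w: "w \<in> sorted_words R k" "act rem_part w \<alpha> = Some \<gamma>"
    by (auto simp: strip_def)
  then have "map_option drop_zeros (rem_boxes w \<alpha>) = Some \<gamma>"
    using drop_zeros_rem_boxes[of w \<alpha>] assms by (simp add: sorted_words_def drop_zeros_composition)
  then obtain \<delta> where "rem_boxes w \<alpha> = Some \<delta>" "\<gamma> = drop_zeros \<delta>" by auto
  moreover have "\<forall>i\<in>set w. 1 \<le> i"
    using w(1) by (metis (mono_tags, lifting) One_nat_def Suc_leI bot_nat_0.not_eq_extremum mem_Collect_eq sorted_words_def)
  ultimately show ?L using w(1) unfolding sorted_words_def by blast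
qed

lemma strip_iff:
  assumes "is_composition \<alpha>"
  shows "removes_horizontal_strip k \<alpha> \<gamma> \<longleftrightarrow> strip (<) k \<alpha> \<gamma>"
    and "removes_vertical_strip k \<alpha> \<gamma> \<longleftrightarrow> strip (\<ge>) k \<alpha> \<gamma>"
  unfolding removes_horizontal_strip_def removes_vertical_strip_def
  by (rule strip_rem_boxes[OF assms])+

lemma strip_composition: "strip R k \<alpha> \<gamma> \<Longrightarrow> is_composition \<alpha> \<Longrightarrow> is_composition \<gamma>"
  by (auto simp: strip_def sorted_words_def dest: act_rem_part)

text \<open>Uniqueness of the word turns the sum over words into a sum in which each resulting list
  is counted once.\<close>

lemma strip_sum:
  assumes "R = (<) \<or> R = (\<ge>)"
  shows "app (word_op rem_part (sorted_words R k)) f \<beta> = (\<Sum>\<gamma> | strip R k \<beta> \<gamma>. f \<gamma>)"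
  unfolding word_op.rep_eq
proof (rule sum.reindex_bij_betw, rule bij_betw_imageI)
  show "inj_on (\<lambda>w. the (act rem_part w \<beta>)) {w. w \<in> sorted_words R k \<and> act rem_part w \<beta> \<noteq> None}"
    using strip_word_unique[OF _ _ assms] by (force simp: inj_on_def)
  show "(\<lambda>w. the (act rem_part w \<beta>)) ` {w. w \<in> sorted_words R k \<and> act rem_part w \<beta> \<noteq> None} =
      {\<gamma>. strip R k \<beta> \<gamma>}"
    by (force simp: strip_def)
qed

lemma finite_strip:
  assumes "R = (<) \<or> R = (\<ge>)"
  shows "finite {\<gamma>. is_composition \<gamma> \<and> strip R k \<gamma> \<alpha>}"
proof -
  have "{\<gamma>. is_composition \<gamma> \<and> strip R k \<gamma> \<alpha>} \<subseteq> {\<gamma>. is_composition \<gamma> \<and> sum_list \<gamma> \<le> sum_list \<alpha> + k}"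
    by (auto simp: strip_def sorted_words_def dest: act_rem_part)
  then show ?thesis using finite_compositions finite_subset by blast
qed

text \<open>The adjoint reading: as a function of its starting point, the operator spreads
  \<open>point \<alpha>\<close> over all compositions from which a strip leads to \<alpha>.\<close>

lemma strip_point:
  assumes "R = (<) \<or> R = (\<ge>)" "is_composition \<beta>"
  shows "app (word_op rem_part (sorted_words R k)) (point \<alpha>) \<beta> =
    (\<Sum>\<gamma> | is_composition \<gamma> \<and> strip R k \<gamma> \<alpha>. point \<gamma> \<beta>)"
proof -
  have "{\<gamma>. strip R k \<beta> \<gamma>} \<subseteq> {\<gamma>. is_composition \<gamma> \<and> sum_list \<gamma> \<le> sum_list \<beta>}"
    using strip_composition assms(2) by (auto simp: strip_def sorted_words_def dest: act_rem_part)
  then have "finite {\<gamma>. strip R k \<beta> \<gamma>}" using finite_compositions finite_subset by blast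
  then show ?thesis
    using assms finite_strip[OF assms(1), of k \<alpha>] by (simp add: strip_sum)
qed

section \<open>Coefficients of skew quasisymmetric Schur functions\<close>

lemma ps_coeff_zero [simp]: "ps_coeff 0 m = 0"
  by (simp add: zero_power_series.rep_eq)

lemma ps_coeff_sum: "ps_coeff (\<Sum>i\<in>I. f i) m = (\<Sum>i\<in>I. ps_coeff (f i) m)"
  by (induction I rule: infinite_finite_induct) (simp_all add: plus_power_series.rep_eq)

lemma ps_coeff_sign: "ps_coeff ((- 1) ^ j * f) m = (- 1) ^ j * ps_coeff f m"
  by (cases "even j") (simp_all add: uminus_power_series.rep_eq)

lemma ps_coeff_mult: "ps_coeff (f * g) m = (\<Sum>(a, b)\<in>splits m. ps_coeff f a * ps_coeff g b)"
  by (simp add: times_power_series.rep_eq)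

section \<open>Index words of monomials and fundamental functions\<close>

abbreviation exps :: "monomial \<Rightarrow> nat \<Rightarrow> nat list"
  where "exps m r \<equiv> map (Poly_Mapping.lookup m) [0..<r]"

text \<open>For \<open>s = 0\<close> and the exponents of a monomial, this is the only sorted index
  word of that monomial.\<close>

fun index_word :: "nat \<Rightarrow> nat list \<Rightarrow> nat list" where
  "index_word s [] = []"
| "index_word s (k # ks) = replicate k s @ index_word (Suc s) ks"

lemma length_index_word [simp]: "length (index_word s ks) = sum_list ks"
  by (induction ks arbitrary: s) auto

lemma set_index_word: "i \<in> set (index_word s ks) \<Longrightarrow> s \<le> i"
  by (induction ks arbitrary: s) (auto split: if_splits dest: Suc_leD)

lemma sorted_index_word: "sorted (index_word s ks)"
  by (induction ks arbitrary: s) (auto simp: sorted_append dest!: set_index_word)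

lemma count_list_index_word:
  "count_list (index_word s ks) i = (if s \<le> i \<and> i < s + length ks then ks ! (i - s) else 0)"
proof (induction ks arbitrary: s)
  case (Cons k ks)
  have "count_list (replicate k s) i = (if i = s then k else 0)"
    by (induction k) auto
  with Cons show ?case by (auto simp: nth_Cons' Suc_diff_le)
qed simp

lemma lookup_monomial_of: "Poly_Mapping.lookup (monomial_of is) i = count_list is i"
  by (induction "is") (auto simp: monomial_of_def lookup_add lookup_single when_def)

lemma sorted_monomial_of_iff:
  assumes "\<forall>i\<ge>r. Poly_Mapping.lookup m i = 0"
  shows "sorted is \<and> monomial_of is = m \<longleftrightarrow> is = index_word 0 (exps m r)"
proof -
  have c: "count_list (index_word 0 (exps m r)) i = Poly_Mapping.lookup m i" for i
    using assms by (simp add: count_list_index_word)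
  show ?thesis
  proof
    assume s: "sorted is \<and> monomial_of is = m"
    then have "count_list is i = Poly_Mapping.lookup m i" for i
      by (metis lookup_monomial_of)
    then have "mset is = mset (index_word 0 (exps m r))"
      by (intro multiset_eqI) (simp add: count_mset c)
    with s show "is = index_word 0 (exps m r)"
      by (metis properties_for_sort sorted_index_word)
  next
    assume "is = index_word 0 (exps m r)"
    then show "sorted is \<and> monomial_of is = m"
      by (auto intro!: poly_mapping_eqI simp: lookup_monomial_of c sorted_index_word)
  qed
qed

text \<open>Neighbours with equal index lie in one block, where the columns must strictly fall; at
  the border of two blocks the index rises, so the columns are free there. The start
  \<open>s\<close> is arbitrary because the induction shifts it.\<close>

lemma row_words_iff_successively:
  "w \<in> row_words ks \<longleftrightarrow> length w = sum_list ks \<and> 0 \<notin> set w \<and>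
    successively (\<lambda>(c, i) (c', i'). c \<le> c' \<longrightarrow> i < i') (zip w (index_word s ks))"
proof (induction ks arbitrary: w s)
  case (Cons k ks)
  let ?P = "\<lambda>(c, i) (c', i'). c \<le> c' \<longrightarrow> i < (i'::nat)"
  have 1: "w \<in> row_words (k # ks) \<longleftrightarrow>
      k \<le> length w \<and> take k w \<in> sorted_words (>) k \<and> drop k w \<in> row_words ks"
  proof
    assume "w \<in> row_words (k # ks)"
    then show "k \<le> length w \<and> take k w \<in> sorted_words (>) k \<and> drop k w \<in> row_words ks"
      by (auto simp: sorted_words_def)
  next
    assume "k \<le> length w \<and> take k w \<in> sorted_words (>) k \<and> drop k w \<in> row_words ks"
    then show "w \<in> row_words (k # ks)"
      unfolding row_words.simps by (intro image_eqI[of _ _ "(take k w, drop k w)"]) simp_all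
  qed
  have 2: "successively ?P (zip u (replicate (length u) s)) \<longleftrightarrow> sorted_wrt (>) u" for u :: "nat list"
  proof -
    have "successively ?P (zip u (replicate (length u) s)) \<longleftrightarrow> successively (>) u"
      by (simp add: successively_conv_nth not_le)
    also have "\<dots> \<longleftrightarrow> sorted_wrt (>) u"
      by (rule successively_iff_sorted_wrt_strong) auto
    finally show ?thesis .
  qed
  have 3: "successively ?P (zip w (index_word s (k # ks))) \<longleftrightarrow>
      sorted_wrt (>) (take k w) \<and> successively ?P (zip (drop k w) (index_word (Suc s) ks))"
    if "length w = k + sum_list ks"
  proof -
    have z: "zip w (index_word s (k # ks)) = zip (take k w) (replicate (length (take k w)) s) @
        zip (drop k w) (index_word (Suc s) ks)"
      using that by (subst zip_append[symmetric]) simp_all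
    have snd_zip: "snd p \<in> set ys" if "p \<in> set (zip xs ys)" for p and xs ys :: "nat list"
      using set_zip_rightD[of "fst p" "snd p" xs ys] that by simp
    have "?P (last (zip u (replicate (length u) s))) (hd (zip v (index_word (Suc s) ks)))"
      if "zip u (replicate (length u) s) \<noteq> []" "zip v (index_word (Suc s) ks) \<noteq> []" for u v :: "nat list"
    proof -
      have "last (zip u (replicate (length u) s)) \<in> set (zip u (replicate (length u) s))"
        "hd (zip v (index_word (Suc s) ks)) \<in> set (zip v (index_word (Suc s) ks))"
        using that by (simp_all only: last_in_set hd_in_set not_False_eq_True)
      from this[THEN snd_zip]
      show ?thesis by (auto simp: case_prod_unfold dest: set_index_word)
    qed
    from this[of "take k w" "drop k w"]
    have "zip (take k w) (replicate (length (take k w)) s) = [] \<or>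
        zip (drop k w) (index_word (Suc s) ks) = [] \<or>
        ?P (last (zip (take k w) (replicate (length (take k w)) s)))
          (hd (zip (drop k w) (index_word (Suc s) ks)))"
      by fast
    then show ?thesis
      by (simp only: z successively_append_iff 2 simp_thms)
  qed
  have s: "0 \<in> set w \<longleftrightarrow> 0 \<in> set (take k w) \<or> 0 \<in> set (drop k w)"
    by (metis Un_iff append_take_drop_id set_append)
  show ?case
  proof (cases "length w = k + sum_list ks")
    case True
    then show ?thesis
      unfolding 1 Cons.IH[of _ "Suc s"] 3[OF True] s by (auto simp: sorted_words_def)
  next
    case False
    then show ?thesis
      unfolding 1 Cons.IH[of _ "Suc s"] by auto
  qed
qed auto

lemma row_words_iff:
  "w \<in> row_words ks \<longleftrightarrow> length w = sum_list ks \<and> 0 \<notin> set w \<and>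
    (\<forall>j. 0 < j \<and> j < length w \<longrightarrow> w ! (j - 1) \<le> w ! j \<longrightarrow> index_word 0 ks ! (j - 1) < index_word 0 ks ! j)"
  unfolding row_words_iff_successively[of w ks 0]
  by (auto simp: successively_conv_nth gr0_conv_Suc)

lemma sum_list_take_differences:
  "sorted (a # xs) \<Longrightarrow> k \<le> length xs \<Longrightarrow>
    sum_list (take k (map2 (-) xs (a # xs))) + a = (a # xs) ! k" for a :: nat
proof (induction xs arbitrary: a k)
  case (Cons x xs)
  show ?case
  proof (cases k)
    case (Suc l)
    then show ?thesis using Cons.IH[of x l] Cons.prems by simp
  qed simp
qed simp

text \<open>The parts are the differences of neighbours in the list 0, S, N, so their partial sums
  telescope to the elements of S and finally to N.\<close>

lemma
  assumes "S \<subseteq> {1..<N}"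
  shows sum_list_comp_of_set: "sum_list (comp_of_set N S) = N"
    and set_of_comp_comp_of_set: "set_of_comp (comp_of_set N S) = S"
proof -
  have fin: "finite S" using assms finite_subset by blast
  let ?s = "sorted_list_of_set S"
  have s: "sorted (0 # ?s @ [N])"
    using assms fin by (auto simp: sorted_append)
  have len: "length (comp_of_set N S) = Suc (length ?s)" by (simp add: comp_of_set_def Let_def)
  have "comp_of_set N S = map2 (-) (?s @ [N]) (0 # ?s @ [N])"
    using zip_append2[of "?s @ [N]" "0 # ?s" "[N]"] by (simp add: comp_of_set_def Let_def)
  then have t: "sum_list (take k (comp_of_set N S)) = (0 # ?s @ [N]) ! k" if "k \<le> Suc (length ?s)" for k
    using sum_list_take_differences[OF s, of k] that by simp
  from t[of "Suc (length ?s)"] len show "sum_list (comp_of_set N S) = N" by (simp add: nth_append)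
  have "set_of_comp (comp_of_set N S) = {?s ! k | k. k < length ?s}"
  proof (intro equalityI subsetI)
    fix x assume "x \<in> set_of_comp (comp_of_set N S)"
    then obtain k where "x = (0 # ?s @ [N]) ! k" "1 \<le> k" "k < Suc (length ?s)"
      by (auto simp: set_of_comp_def len t)
    then show "x \<in> {?s ! k | k. k < length ?s}"
      by (intro CollectI exI[of _ "k - 1"]) (simp add: nth_Cons' nth_append)
  next
    fix x assume "x \<in> {?s ! k | k. k < length ?s}"
    then obtain k where "x = ?s ! k" "k < length ?s" by auto
    then show "x \<in> set_of_comp (comp_of_set N S)"
      by (auto simp: set_of_comp_def len t nth_append intro!: exI[of _ "Suc k"])
  qed
  also have "\<dots> = S" using fin by (metis set_conv_nth set_sorted_list_of_set)
  finally show "set_of_comp (comp_of_set N S) = S" .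
qed

text \<open>A monomial has just one sorted index word, so every coefficient is 0 or 1.\<close>

lemma ps_coeff_fundamental:
  assumes "S \<subseteq> {1..<N}" "\<forall>i\<ge>r. Poly_Mapping.lookup m i = 0"
  defines "v \<equiv> index_word 0 (exps m r)"
  shows "ps_coeff (fundamental (comp_of_set N S)) m =
    (if sum_list (exps m r) = N \<and> (\<forall>j\<in>S. v ! (j - 1) < v ! j) then 1 else 0)"
proof -
  have "{is \<in> fundamental_words (comp_of_set N S). monomial_of is = m} =
      (if length v = N \<and> (\<forall>j\<in>S. v ! (j - 1) < v ! j) then {v} else {})"
  proof -
    have "is \<in> fundamental_words (comp_of_set N S) \<and> monomial_of is = m \<longleftrightarrow>
        is = v \<and> length is = N \<and> (\<forall>j\<in>S. is ! (j - 1) < is ! j)" for "is"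
      using sorted_monomial_of_iff[OF assms(2), of "is"]
      unfolding fundamental_words_def sum_list_comp_of_set[OF assms(1)]
        set_of_comp_comp_of_set[OF assms(1)] v_def by blast
    then show ?thesis by auto
  qed
  then show ?thesis by (simp add: fundamental_def Abs_ps_inverse v_def)
qed

section \<open>Saturated chains as words\<close>

lemma diagram_add_box:
  assumes "add_box i \<gamma> = Some \<delta>"
  shows "\<exists>r. diagram \<delta> - diagram \<gamma> = {(r, i)}"
proof -
  consider "i = 0" | "i = 1" | j where "i = Suc (Suc j)"
    by (metis One_nat_def not0_implies_Suc)
  then show ?thesis
  proof cases
    case 1
    with assms show ?thesis by simp
  next
    case 2
    with assms have "\<delta> = 1 # \<gamma>" by simp
    then have "diagram \<delta> - diagram \<gamma> = {(length \<gamma>, i)}"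
      by (auto simp: diagram_def nth_append 2 split: if_splits)
    then show ?thesis ..
  next
    case (3 j)
    let ?P = "\<lambda>k. k < length \<gamma> \<and> \<gamma> ! k = i - 1"
    define k where "k = Least ?P"
    have i: "i - 1 \<in> set \<gamma>" and g: "\<delta> = \<gamma>[k := i]"
      using assms 3 by (auto simp: add_box_def k_def split: if_splits)
    then obtain l where "?P l" by (auto simp: in_set_conv_nth)
    then have k: "k < length \<gamma>" "\<gamma> ! k = i - 1" using LeastI[of ?P] by (auto simp: k_def)
    have "diagram \<delta> - diagram \<gamma> = {(length \<gamma> - k - 1, i)}"
    proof (intro equalityI subsetI)
      fix x assume "x \<in> diagram \<delta> - diagram \<gamma>"
      moreover obtain r c where "x = (r, c)" by (cases x)
      ultimately show "x \<in> {(length \<gamma> - k - 1, i)}"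
        using k 3 by (auto simp: diagram_def g rev_update nth_list_update rev_nth split: if_splits)
    next
      fix x assume "x \<in> {(length \<gamma> - k - 1, i)}"
      then show "x \<in> diagram \<delta> - diagram \<gamma>"
        using k 3 by (simp add: diagram_def g rev_update rev_nth)
    qed
    then show ?thesis ..
  qed
qed

primrec chain_of :: "nat list \<Rightarrow> nat list \<Rightarrow> nat list list" where
  "chain_of \<beta> [] = [\<beta>]"
| "chain_of \<beta> (i # w) = chain_of \<beta> w @ [the (act add_box (i # w) \<beta>)]"

lemma length_chain_of [simp]: "length (chain_of \<beta> w) = Suc (length w)"
  by (induction w) auto

lemma chain_of_neq_Nil [simp]: "chain_of \<beta> w \<noteq> []"
  by (cases w) auto

lemma chain_of_nth:
  "k \<le> length w \<Longrightarrow> chain_of \<beta> w ! k = the (act add_box (drop (length w - k) w) \<beta>)"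
proof (induction w)
  case (Cons i w)
  then show ?case by (cases "k = Suc (length w)") (auto simp: nth_append Suc_diff_le)
qed simp

lemma saturated_chain_of:
  assumes "is_composition \<beta>"
  shows "act add_box w \<beta> = Some \<alpha> \<Longrightarrow> saturated_chain \<beta> \<alpha> (chain_of \<beta> w)"
proof (induction w arbitrary: \<alpha>)
  case (Cons i w)
  then obtain \<gamma> where g: "act add_box w \<beta> = Some \<gamma>" "add_box i \<gamma> = Some \<alpha>"
    by (auto simp: act_Cons bind_eq_Some_conv)
  have "is_composition \<gamma>" using act_add_box[OF g(1)] assms by simp
  moreover have "1 \<le> i" using g(2) by (cases i) auto
  ultimately have "covers_c \<gamma> \<alpha>" using g(2) by (auto simp: covers_c_def)
  with Cons.IH[OF g(1)] Cons.prems show ?case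
    by (auto simp: saturated_chain_def successively_append_iff)
qed (simp add: saturated_chain_def)

lemma chain_of_surj:
  "saturated_chain \<beta> \<alpha> c \<Longrightarrow> \<exists>w. act add_box w \<beta> = Some \<alpha> \<and> c = chain_of \<beta> w"
proof (induction c arbitrary: \<alpha> rule: rev_induct)
  case (snoc x c)
  show ?case
  proof (cases "c = []")
    case True
    with snoc.prems show ?thesis
      by (intro exI[of _ "[]"]) (auto simp: saturated_chain_def)
  next
    case False
    with snoc.prems have "saturated_chain \<beta> (last c) c" "covers_c (last c) \<alpha>" and x: "x = \<alpha>"
      by (auto simp: saturated_chain_def successively_append_iff)
    then obtain w where w: "act add_box w \<beta> = Some (last c)" "c = chain_of \<beta> w"
      using snoc.IH by blast
    from \<open>covers_c (last c) \<alpha>\<close> obtain i where i: "add_box i (last c) = Some \<alpha>"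
      by (auto simp: covers_c_def)
    have "act add_box (i # w) \<beta> = Some \<alpha>"
      unfolding act_Cons w(1) using i by simp
    moreover from this have "c @ [x] = chain_of \<beta> (i # w)" using w(2) x by simp
    ultimately show ?thesis by blast
  qed
qed (simp add: saturated_chain_def)

lemma tableau_step:
  assumes "act add_box w \<beta> = Some \<alpha>" "1 \<le> k" "k \<le> length w"
  shows "\<exists>r. diagram (chain_of \<beta> w ! k) - diagram (chain_of \<beta> w ! (k - 1)) = {(r, w ! (length w - k))}"
proof -
  let ?j = "length w - k"
  have d: "drop ?j w = w ! ?j # drop (Suc ?j) w"
    using assms by (simp add: Cons_nth_drop_Suc)
  have "Option.bind (act add_box (drop ?j w) \<beta>) (act add_box (take ?j w)) = Some \<alpha>"
    using assms(1) by (simp flip: act_append)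
  then obtain \<delta> where D: "act add_box (drop ?j w) \<beta> = Some \<delta>" by (auto simp: bind_eq_Some_conv)
  then obtain \<gamma> where G: "act add_box (drop (Suc ?j) w) \<beta> = Some \<gamma>" "add_box (w ! ?j) \<gamma> = Some \<delta>"
    unfolding d by (auto simp: act_Cons bind_eq_Some_conv)
  have "length w - (k - 1) = Suc ?j" using assms by simp
  then have "chain_of \<beta> w ! k = \<delta>" "chain_of \<beta> w ! (k - 1) = \<gamma>"
    using assms D G by (simp_all add: chain_of_nth)
  with diagram_add_box[OF G(2)] show ?thesis by simp
qed

text \<open>Entries count the steps backwards and letters act from the right; the two reversals
  cancel, so letter j is the column of entry j.\<close>

lemma tableau_of_chain_of:
  assumes "act add_box w \<beta> = Some \<alpha>"
  shows "(\<exists>r. ((r, c), j) \<in> tableau_of_chain (chain_of \<beta> w)) \<longleftrightarrow> 1 \<le> j \<and> j \<le> length w \<and> c = w ! (j - 1)"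
proof
  assume "\<exists>r. ((r, c), j) \<in> tableau_of_chain (chain_of \<beta> w)"
  then obtain r k where k: "j = length w - k + 1" "1 \<le> k" "k \<le> length w"
    "(r, c) \<in> diagram (chain_of \<beta> w ! k) - diagram (chain_of \<beta> w ! (k - 1))"
    by (auto simp: tableau_of_chain_def Let_def)
  with tableau_step[OF assms k(2,3)] show "1 \<le> j \<and> j \<le> length w \<and> c = w ! (j - 1)" by auto
next
  assume j: "1 \<le> j \<and> j \<le> length w \<and> c = w ! (j - 1)"
  define k where "k = length w - j + 1"
  have k: "1 \<le> k" "k \<le> length w" "j = length w - k + 1" "length w - k = j - 1"
    using j by (auto simp: k_def)
  from tableau_step[OF assms k(1,2)] j obtain r where
    "(r, c) \<in> diagram (chain_of \<beta> w ! k) - diagram (chain_of \<beta> w ! (k - 1))"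
    by (auto simp: k(4))
  then have "((r, c), length w - k + 1) \<in> tableau_of_chain (chain_of \<beta> w)"
    unfolding tableau_of_chain_def Let_def
    using k(1,2) by (intro CollectI exI[of _ "(r, c)"] exI[of _ k]) simp
  then show "\<exists>r. ((r, c), j) \<in> tableau_of_chain (chain_of \<beta> w)"
    unfolding k(3)[symmetric] ..
qed

lemma descents_chain_of:
  assumes "act add_box w \<beta> = Some \<alpha>"
  shows "descents (tableau_of_chain (chain_of \<beta> w)) = {j. 1 \<le> j \<and> j < length w \<and> w ! (j - 1) \<le> w ! j}"
proof -
  let ?T = "tableau_of_chain (chain_of \<beta> w)"
  have "j \<in> descents ?T \<longleftrightarrow>
      (\<exists>c c'. (\<exists>r. ((r, c), j) \<in> ?T) \<and> (\<exists>r. ((r, c'), j + 1) \<in> ?T) \<and> c \<le> c')" for j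
    unfolding descents_def by blast
  also have "\<dots> j \<longleftrightarrow> 1 \<le> j \<and> j < length w \<and> w ! (j - 1) \<le> w ! j" for j
    unfolding tableau_of_chain_of[OF assms] by auto
  finally show ?thesis by blast
qed

text \<open>A tableau gives back its word as the list of the columns of its entries 1, 2, and so on;
  this yields injectivity.\<close>

lemma standard_tableaux_words:
  assumes "is_composition \<beta>"
  shows "bij_betw (\<lambda>w. tableau_of_chain (chain_of \<beta> w)) {w. act add_box w \<beta> = Some \<alpha>} (standard_tableaux \<alpha> \<beta>)"
proof (rule bij_betw_imageI)
  show "inj_on (\<lambda>w. tableau_of_chain (chain_of \<beta> w)) {w. act add_box w \<beta> = Some \<alpha>}"
  proof (rule inj_onI, clarify)
    fix v w
    assume v: "act add_box v \<beta> = Some \<alpha>" and w: "act add_box w \<beta> = Some \<alpha>"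
      and e: "tableau_of_chain (chain_of \<beta> v) = tableau_of_chain (chain_of \<beta> w)"
    have l: "length v = length w" using act_add_box[OF v] act_add_box[OF w] by simp
    show "v = w"
    proof (rule nth_equalityI[OF l])
      fix j assume "j < length v"
      then show "v ! j = w ! j"
        using tableau_of_chain_of[OF v, of "v ! j" "Suc j"] tableau_of_chain_of[OF w, of "v ! j" "Suc j"]
        by (simp add: e)
    qed
  qed
  show "(\<lambda>w. tableau_of_chain (chain_of \<beta> w)) ` {w. act add_box w \<beta> = Some \<alpha>} = standard_tableaux \<alpha> \<beta>"
    unfolding standard_tableaux_def using saturated_chain_of[OF assms] chain_of_surj by blast
qed

lemma act_add_box_less_c:
  assumes "is_composition \<beta>"
  shows "act add_box w \<beta> = Some \<alpha> \<Longrightarrow> \<alpha> = \<beta> \<or> less_c \<beta> \<alpha>"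
proof (induction w arbitrary: \<alpha>)
  case (Cons i w)
  then obtain \<gamma> where g: "act add_box w \<beta> = Some \<gamma>" "add_box i \<gamma> = Some \<alpha>"
    by (auto simp: act_Cons bind_eq_Some_conv)
  have "is_composition \<gamma>" using act_add_box[OF g(1)] assms by simp
  moreover have "1 \<le> i" using g(2) by (cases i) auto
  ultimately have "covers_c \<gamma> \<alpha>" using g(2) by (auto simp: covers_c_def)
  with Cons.IH[OF g(1)] show ?case
    unfolding less_c_def by (auto intro: tranclp.intros)
qed simp

text \<open>A tableau contributes 1 to the coefficient of \<open>m\<close> if the index word of
  \<open>m\<close> has the right length and rises at all descents, which says that its word splits
  into strictly decreasing blocks of the lengths given by the exponents.\<close>

lemma skew_schur_coeff:
  assumes "is_composition \<alpha>" "is_composition \<beta>" "\<forall>i\<ge>r. Poly_Mapping.lookup m i = 0"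
  shows "ps_coeff (skew_schur \<alpha> \<beta>) m = app (rows_op (exps m r)) (point \<alpha>) \<beta>"
proof -
  let ?W = "{w. act add_box w \<beta> = Some \<alpha>}"
  have len: "length w = sum_list \<alpha> - sum_list \<beta>" "0 \<notin> set w" if "w \<in> ?W" for w
    using that by (auto dest: act_add_box)
  have "ps_coeff (skew_schur \<alpha> \<beta>) m = of_nat (card {w \<in> row_words (exps m r). act add_box w \<beta> = Some \<alpha>})"
  proof (cases "\<alpha> = \<beta>")
    case True
    \<comment> \<open>Adding boxes increases the size, so only the empty word returns to \<beta>;
      this matches the value 1 of the function.\<close>
    have "{w \<in> row_words (exps m r). act add_box w \<beta> = Some \<beta>} = (if m = 0 then {[]} else {})"
    proof -
      have "[] \<in> row_words (exps m r) \<longleftrightarrow> m = 0"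
      proof
        assume "[] \<in> row_words (exps m r)"
        then have "\<forall>i<r. Poly_Mapping.lookup m i = 0"
          using length_row_words by fastforce
        with assms(3) show "m = 0"
          by (intro poly_mapping_eqI) (metis leI lookup_zero)
      qed (simp add: row_words_iff)
      moreover have "act add_box w \<beta> = Some \<beta> \<longleftrightarrow> w = []" for w
        by (auto dest: act_add_box)
      ultimately show ?thesis by auto
    qed
    then show ?thesis by (simp add: True skew_schur_def one_power_series.rep_eq)
  next
    case False
    show ?thesis
    proof (cases "less_c \<beta> \<alpha>")
      case True
      let ?N = "sum_list \<alpha> - sum_list \<beta>"
      have fin: "finite ?W"
        using bij_betw_finite[OF standard_tableaux_words[OF assms(2)]]
          finite_standard_tableaux[OF assms(1)] by blast
      have "ps_coeff (skew_schur \<alpha> \<beta>) m =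
          (\<Sum>\<tau>\<in>standard_tableaux \<alpha> \<beta>. ps_coeff (fundamental (comp_of_set ?N (descents \<tau>))) m)"
        using False True by (simp add: skew_schur_def ps_coeff_sum)
      also have "\<dots> = (\<Sum>w\<in>?W. ps_coeff (fundamental (comp_of_set ?N
          (descents (tableau_of_chain (chain_of \<beta> w))))) m)"
        by (rule sum.reindex_bij_betw[OF standard_tableaux_words[OF assms(2)], symmetric])
      also have "\<dots> = (\<Sum>w\<in>?W. if w \<in> row_words (exps m r) then 1 else 0)"
      proof (rule sum.cong[OF refl])
        fix w assume w: "w \<in> ?W"
        let ?D = "{j. 1 \<le> j \<and> j < length w \<and> w ! (j - 1) \<le> w ! j}"
        have "?D \<subseteq> {1..<length w}" by auto
        from ps_coeff_fundamental[OF this assms(3)] w len[OF w]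
        show "ps_coeff (fundamental (comp_of_set ?N (descents (tableau_of_chain (chain_of \<beta> w))))) m =
            (if w \<in> row_words (exps m r) then 1 else 0)"
          by (auto simp: descents_chain_of row_words_iff Suc_le_eq)
      qed
      also have "\<dots> = of_nat (card {w \<in> row_words (exps m r). act add_box w \<beta> = Some \<alpha>})"
        using fin by (simp add: sum.If_cases Int_def conj_commute)
      finally show ?thesis .
    next
      case nless: False
      then have "?W = {}" using False act_add_box_less_c[OF assms(2)] by blast
      then show ?thesis using False nless by (simp add: skew_schur_def)
    qed
  qed
  then show ?thesis by (simp only: rows_op_point)
qed

text \<open>A factorization of \<open>m\<close> is determined by the exponents of its second factor,
  which may be any list dominated by the exponents of \<open>m\<close>.\<close>

lemma splits_sum:
  assumes "\<forall>i\<ge>r. Poly_Mapping.lookup m i = 0"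
  shows "(\<Sum>(a, b)\<in>splits m. F (exps a r) (exps b r)) =
    (\<Sum>ss\<in>dominated (exps m r). F (map2 (-) (exps m r) ss) ss)"
proof -
  let ?h = "\<lambda>(a :: monomial, b :: monomial). exps b r"
  have "bij_betw ?h (splits m) (dominated (exps m r))"
  proof (rule bij_betw_imageI)
    show "inj_on ?h (splits m)"
    proof (rule inj_onI, clarify)
      fix a b a' b'
      assume s: "(a, b) \<in> splits m" "(a', b') \<in> splits m" and e: "exps b r = exps b' r"
      have "Poly_Mapping.lookup b i = Poly_Mapping.lookup b' i" for i
      proof (cases "i < r")
        case True
        then show ?thesis using arg_cong[OF e, of "\<lambda>l. l ! i"] by simp
      next
        case False
        have "Poly_Mapping.lookup a i + Poly_Mapping.lookup b i = 0"
          "Poly_Mapping.lookup a' i + Poly_Mapping.lookup b' i = 0"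
          using s assms False by (auto simp: splits_def lookup_add[symmetric])
        then show ?thesis by simp
      qed
      then have "b = b'" by (rule poly_mapping_eqI)
      with s show "a = a' \<and> b = b'" by (auto simp: splits_def)
    qed
    show "?h ` splits m = dominated (exps m r)"
    proof (intro equalityI subsetI)
      fix ss assume ss: "ss \<in> dominated (exps m r)"
      then have len: "length ss = r" by (auto dest: list_all2_lengthD)
      have le: "ss ! i \<le> Poly_Mapping.lookup m i" if "i < r" for i
        using list_all2_nthD2[of "(\<le>)" ss "exps m r" i] ss that by simp
      define b :: monomial where "b = (\<Sum>i<r. Poly_Mapping.single i (ss ! i))"
      have b: "Poly_Mapping.lookup b i = (if i < r then ss ! i else 0)" for i
        by (simp add: b_def lookup_sum lookup_single when_def)
      have "m - b + b = m"
        by (rule poly_mapping_eqI) (use assms in \<open>auto simp: lookup_add lookup_minus b le\<close>)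
      moreover have "exps b r = ss"
        by (rule nth_equalityI) (simp_all add: b len)
      ultimately show "ss \<in> ?h ` splits m"
        unfolding splits_def by (intro image_eqI[of _ _ "(m - b, b)"]) simp_all
    qed (auto simp: splits_def lookup_add list_all2_conv_all_nth)
  qed
  then have "(\<Sum>ss\<in>dominated (exps m r). F (map2 (-) (exps m r) ss) ss) =
      (\<Sum>p\<in>splits m. F (map2 (-) (exps m r) (?h p)) (?h p))"
    by (rule sum.reindex_bij_betw[symmetric])
  also have "\<dots> = (\<Sum>(a, b)\<in>splits m. F (exps a r) (exps b r))"
  proof (rule sum.cong[OF refl], clarify)
    fix a b assume "(a, b) \<in> splits m"
    then have "map2 (-) (exps m r) (exps b r) = exps a r"
      by (intro nth_equalityI) (auto simp: splits_def lookup_add)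
    then show "F (map2 (-) (exps m r) (exps b r)) (exps b r) = F (exps a r) (exps b r)" by simp
  qed
  finally show ?thesis by simp
qed

section \<open>One-row and one-column functions\<close>

lemma strictly_decreasing_in_row_words:
  "0 \<notin> set w \<Longrightarrow> sorted_wrt (>) w \<Longrightarrow> length w = sum_list ks \<Longrightarrow> w \<in> row_words ks"
proof (induction ks arbitrary: w)
  case (Cons k ks)
  have "take k w \<in> sorted_words (>) k" "drop k w \<in> row_words ks"
    using Cons.prems Cons.IH[of "drop k w"] by (auto simp: sorted_words_def sorted_wrt_take
        sorted_wrt_drop dest: in_set_takeD in_set_dropD)
  then show ?case
    unfolding row_words.simps by (intro image_eqI[of _ _ "(take k w, drop k w)"]) simp_all
qed simp

lemma ones_in_row_words:
  "replicate n (Suc 0) \<in> row_words ks \<longleftrightarrow> n = sum_list ks \<and> (\<forall>k\<in>set ks. k \<le> 1)"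
proof (induction ks arbitrary: n)
  case (Cons k ks)
  have ones: "replicate k (Suc 0) \<in> sorted_words (>) k \<longleftrightarrow> k \<le> 1"
    by (cases k; cases "k - 1") (auto simp: sorted_words_def)
  have "replicate n (Suc 0) \<in> row_words (k # ks) \<longleftrightarrow>
      (\<exists>u v. replicate n (Suc 0) = u @ v \<and> u \<in> sorted_words (>) k \<and> v \<in> row_words ks)"
    by auto
  also have "\<dots> \<longleftrightarrow> k \<le> n \<and> replicate k (Suc 0) \<in> sorted_words (>) k \<and>
      replicate (n - k) (Suc 0) \<in> row_words ks" (is "?L \<longleftrightarrow> ?R")
  proof
    assume ?L
    then obtain u v where uv: "replicate n (Suc 0) = u @ v" "u \<in> sorted_words (>) k"
      "v \<in> row_words ks" by blast
    then have "length u = k" by (simp add: sorted_words_def)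
    moreover have "u = replicate (length u) (Suc 0)" "v = replicate (length v) (Suc 0)"
      "n = length u + length v"
      using uv(1) by (metis append_eq_conv_conj length_replicate take_replicate drop_replicate
          length_append min_def diff_add_inverse le_add1)+
    ultimately show ?R using uv by simp
  next
    assume ?R
    then show ?L
      by (intro exI[of _ "replicate k (Suc 0)"] exI[of _ "replicate (n - k) (Suc 0)"])
         (simp flip: replicate_add)
  qed
  finally show ?case unfolding ones Cons by auto
qed auto

lemma add_box_singleton:
  "add_box i \<gamma> = Some [Suc n] \<longleftrightarrow> i = Suc n \<and> \<gamma> = (if n = 0 then [] else [n])"
proof -
  consider "i = 0" | "i = 1" | j where "i = Suc (Suc j)"
    by (metis One_nat_def not0_implies_Suc)
  then show ?thesis
  proof cases
    case 3
    have "add_box i xs \<noteq> Some []" for xs using add_box_size[of i xs "[]"] by auto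
    with 3 show ?thesis by (cases \<gamma>) auto
  qed auto
qed

lemma act_add_box_Nil_iff: "act add_box w [] = Some [] \<longleftrightarrow> w = []"
  by (auto dest: act_add_box)

lemma act_add_box_singleton:
  "act add_box w [] = Some [Suc n] \<longleftrightarrow> w = rev [1..<Suc (Suc n)]"
proof (induction n arbitrary: w)
  case 0
  show ?case
    by (cases w) (auto simp: act_Cons bind_eq_Some_conv add_box_singleton act_add_box_Nil_iff)
next
  case (Suc n)
  have "rev [1..<Suc (Suc (Suc n))] = Suc (Suc n) # rev [1..<Suc (Suc n)]" by simp
  with Suc show ?case
    by (cases w) (auto simp: act_Cons bind_eq_Some_conv add_box_singleton simp del: upt_Suc)
qed

lemma act_add_box_ones:
  "act add_box w [] = Some (replicate n (Suc 0)) \<longleftrightarrow> w = replicate n (Suc 0)"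
proof (induction n arbitrary: w)
  case 0
  show ?case by (simp add: act_add_box_Nil_iff)
next
  case (Suc n)
  have "add_box i \<gamma> = Some (replicate (Suc n) (Suc 0)) \<longleftrightarrow> i = 1 \<and> \<gamma> = replicate n (Suc 0)" for i \<gamma>
    using add_box_in_set[of "i - 1" \<gamma> "replicate (Suc n) (Suc 0)"] by (cases i) auto
  with Suc show ?case
    by (cases w) (auto simp: act_Cons bind_eq_Some_conv)
qed

text \<open>The only word leading to (n) is n, ..., 1. It has no descent, so every monomial of
  degree n occurs once: this is the complete symmetric function.\<close>

lemma quasi_schur_row_coeff:
  assumes "0 < n" "\<forall>i\<ge>r. Poly_Mapping.lookup b i = 0"
  shows "ps_coeff (quasi_schur [n]) b = (if sum_list (exps b r) = n then 1 else 0)"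
proof -
  obtain k where n: "n = Suc k" using assms(1) by (cases n) auto
  define v where "v = rev [1..<Suc (Suc k)]"
  have "sorted_wrt (>) v" unfolding v_def sorted_wrt_rev by (simp del: upt_Suc)
  moreover have "0 \<notin> set v" "length v = n" by (auto simp: v_def n)
  ultimately have "v \<in> row_words (exps b r) \<longleftrightarrow> sum_list (exps b r) = n"
    using strictly_decreasing_in_row_words length_row_words by metis
  then have "{w \<in> row_words (exps b r). w = v} = (if sum_list (exps b r) = n then {v} else {})"
    by auto
  moreover have "act add_box w [] = Some [n] \<longleftrightarrow> w = v" for w
    unfolding n v_def by (rule act_add_box_singleton)
  moreover have "is_composition [n]" "is_composition []" using n by (auto simp: is_composition_def)
  ultimately show ?thesis
    using skew_schur_coeff[OF _ _ assms(2), of "[n]" "[]"] by (simp add: rows_op_point)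
qed

text \<open>The only word is 1, ..., 1, with a descent at every place, so no variable can be
  repeated: this is the elementary symmetric function.\<close>

lemma quasi_schur_column_coeff:
  assumes "\<forall>i\<ge>r. Poly_Mapping.lookup b i = 0"
  shows "ps_coeff (quasi_schur (replicate n 1)) b =
    (if sum_list (exps b r) = n then if \<forall>k\<in>set (exps b r). k \<le> 1 then 1 else 0 else 0)"
proof -
  let ?w = "replicate n (Suc 0)"
  have "{w \<in> row_words (exps b r). w = ?w} =
      (if sum_list (exps b r) = n \<and> (\<forall>k\<in>set (exps b r). k \<le> 1) then {?w} else {})"
    using ones_in_row_words[of n "exps b r"] by auto
  moreover have "is_composition ?w" "is_composition []" by (auto simp: is_composition_def)
  ultimately show ?thesis
    using skew_schur_coeff[OF _ _ assms, of ?w "[]"]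
    by (simp add: rows_op_point act_add_box_ones)
qed

section \<open>The product rule for a pair of inverse strip series\<close>

lemma prod_list_le_1:
  "prod_list (map (\<lambda>k. if k \<le> 1 then 1 else 0) ks) = (if \<forall>k\<in>set ks. k \<le> (1::nat) then 1 else (0::nat))"
  by (induction ks) auto

text \<open>Both formulas in one: \<open>R1\<close> is the type of the strips between \<alpha> and
  the larger shapes, \<open>R2\<close> that of the strips removed from \<beta>, and the sum of c(s)
  (x z)^s is the factor of one variable in the generating function of which \<open>S\<close> is the
  coefficient of z^n.\<close>

lemma skew_pieri:
  assumes comp: "is_composition \<alpha>" "is_composition \<beta>"
    and R: "R1 = (<) \<or> R1 = (\<ge>)" "R2 = (<) \<or> R2 = (\<ge>)"
    and inverse: "Abs_fps (\<lambda>k. (- 1) ^ k * word_op rem_part (sorted_words R2 k)) *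
      Abs_fps (\<lambda>k. word_op rem_part (sorted_words R1 k)) = 1"
    and commute: "\<And>k. fps_const (row_op k) * Abs_fps (\<lambda>k. word_op rem_part (sorted_words R1 k)) =
      Abs_fps (\<lambda>k. word_op rem_part (sorted_words R1 k)) * row_fps c k"
    and S: "\<And>b r. \<forall>i\<ge>r. Poly_Mapping.lookup b i = 0 \<Longrightarrow> ps_coeff S b =
      (if sum_list (exps b r) = n then of_nat (prod_list (map c (exps b r))) else 0)"
  shows "skew_schur \<alpha> \<beta> * S =
    (\<Sum>(i, j) \<in> {(i, j). i + j = n}. \<Sum>\<alpha>p | is_composition \<alpha>p \<and> strip R1 i \<alpha>p \<alpha>.
      \<Sum>\<beta>m | is_composition \<beta>m \<and> strip R2 j \<beta> \<beta>m. (- 1) ^ j * skew_schur \<alpha>p \<beta>m)"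
proof (rule power_series_eqI)
  fix m :: monomial
  \<comment> \<open>All variables dividing \<open>m\<close> have an index below r, so the exponent
    list can be cut there.\<close>
  define r where "r = Suc (Max (insert 0 (Poly_Mapping.keys m)))"
  have r: "\<forall>i\<ge>r. Poly_Mapping.lookup m i = 0"
  proof (intro allI impI)
    fix i assume "r \<le> i"
    then have "i \<notin> Poly_Mapping.keys m"
      using Max_ge[of "insert 0 (Poly_Mapping.keys m)" i] by (fastforce simp: r_def)
    then show "Poly_Mapping.lookup m i = 0" by (simp add: in_keys_iff)
  qed
  let ?X = "\<lambda>k. word_op rem_part (sorted_words R1 k)"
  let ?Y = "\<lambda>k. word_op rem_part (sorted_words R2 k)"
  let ?P = "rows_op (exps m r)"
  let ?A = "\<lambda>i. {\<alpha>p. is_composition \<alpha>p \<and> strip R1 i \<alpha>p \<alpha>}"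
  let ?B = "\<lambda>j. {\<beta>m. is_composition \<beta>m \<and> strip R2 j \<beta> \<beta>m}"
  have "ps_coeff (skew_schur \<alpha> \<beta> * S) m = (\<Sum>(a, b)\<in>splits m. app (rows_op (exps a r)) (point \<alpha>) \<beta> *
      (if sum_list (exps b r) = n then of_nat (prod_list (map c (exps b r))) else 0))"
    unfolding ps_coeff_mult
  proof (rule sum.cong[OF refl], clarify)
    fix a b assume "(a, b) \<in> splits m"
    with r have "\<forall>i\<ge>r. Poly_Mapping.lookup a i = 0" "\<forall>i\<ge>r. Poly_Mapping.lookup b i = 0"
      by (auto simp: splits_def lookup_add)
    then show "ps_coeff (skew_schur \<alpha> \<beta>) a * ps_coeff S b = app (rows_op (exps a r)) (point \<alpha>) \<beta> *
      (if sum_list (exps b r) = n then of_nat (prod_list (map c (exps b r))) else 0)"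
      using S skew_schur_coeff[OF comp] by simp
  qed
  also have "\<dots> = app (rows_fps c (exps m r) $ n) (point \<alpha>) \<beta>"
    unfolding rows_fps_nth app_sum_left splits_sum[OF r, of "\<lambda>as bs. app (rows_op as) (point \<alpha>) \<beta> *
      (if sum_list bs = n then of_nat (prod_list (map c bs)) else 0)"]
    by (rule sum.cong) (auto simp: app_of_nat_mult simp del: app_simps(6))
  \<comment> \<open>Multiplication by \<open>inverse\<close> inserts both strip series on the left;
    the inner one then moves to the right through all variables, which turns \<open>rows_fps\<close>
    back into \<open>rows_op\<close>.\<close>
  also have "rows_fps c (exps m r) =
      Abs_fps (\<lambda>k. (- 1) ^ k * ?Y k) * (fps_const ?P * Abs_fps ?X)"
    unfolding rows_fps_commute[OF commute] by (simp add: inverse flip: mult.assoc)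
  \<comment> \<open>Under pull-back the leftmost operator acts first: \<open>?Y j\<close> removes a
    strip from \<beta>, \<open>?P\<close> adds boxes, and \<open>?X (n - j)\<close> leads from the
    enlarged shape down to \<alpha>.\<close>
  also have "app (\<dots> $ n) (point \<alpha>) \<beta> =
      (\<Sum>j=0..n. (- 1) ^ j * app (?Y j) (app ?P (app (?X (n - j)) (point \<alpha>))) \<beta>)"
    by (simp add: fps_mult_nth[of "Abs_fps _"] app_sum_left app_sign)
  also have "\<dots> = (\<Sum>j=0..n. ps_coeff (\<Sum>\<alpha>p\<in>?A (n - j). \<Sum>\<beta>m\<in>?B j. (- 1) ^ j * skew_schur \<alpha>p \<beta>m) m)"
  proof (rule sum.cong[OF refl])
    fix j
    have P: "app ?P (app (?X i) (point \<alpha>)) \<gamma> = (\<Sum>\<alpha>p\<in>?A i. ps_coeff (skew_schur \<alpha>p \<gamma>) m)"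
      if "is_composition \<gamma>" for i \<gamma>
    proof -
      have "app ?P (app (?X i) (point \<alpha>)) \<gamma> = app ?P (\<lambda>x. \<Sum>\<alpha>p\<in>?A i. point \<alpha>p x) \<gamma>"
        unfolding rows_op_words
      \<comment> \<open>\<open>strip_point\<close> speaks of compositions, and adding boxes to the
        composition \<gamma> reaches nothing else.\<close>
      proof (rule word_op_cong)
        fix w y assume "act add_box w \<gamma> = Some y"
        with that have "is_composition y" by (auto dest: act_add_box)
        then show "app (?X i) (point \<alpha>) y = (\<Sum>\<alpha>p\<in>?A i. point \<alpha>p y)"
          by (rule strip_point[OF R(1)])
      qed
      then show ?thesis by (simp add: app_sum skew_schur_coeff[OF _ that r])
    qed
    have B: "{\<gamma>. strip R2 j \<beta> \<gamma>} = ?B j" using strip_composition comp(2) by blast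
    have "(- 1) ^ j * app (?Y j) (app ?P (app (?X (n - j)) (point \<alpha>))) \<beta> =
        (\<Sum>\<beta>m\<in>?B j. \<Sum>\<alpha>p\<in>?A (n - j). (- 1) ^ j * ps_coeff (skew_schur \<alpha>p \<beta>m) m)"
      unfolding strip_sum[OF R(2)] B by (simp add: P sum_distrib_left)
    also have "\<dots> = ps_coeff (\<Sum>\<alpha>p\<in>?A (n - j). \<Sum>\<beta>m\<in>?B j. (- 1) ^ j * skew_schur \<alpha>p \<beta>m) m"
      by (subst sum.swap) (simp add: ps_coeff_sum ps_coeff_sign)
    finally show "(- 1) ^ j * app (?Y j) (app ?P (app (?X (n - j)) (point \<alpha>))) \<beta> =
        ps_coeff (\<Sum>\<alpha>p\<in>?A (n - j). \<Sum>\<beta>m\<in>?B j. (- 1) ^ j * skew_schur \<alpha>p \<beta>m) m" .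
  qed
  also have "\<dots> = (\<Sum>(i, j) \<in> {(i, j). i + j = n}.
      ps_coeff (\<Sum>\<alpha>p\<in>?A i. \<Sum>\<beta>m\<in>?B j. (- 1) ^ j * skew_schur \<alpha>p \<beta>m) m)"
    by (rule sum.reindex_bij_witness[of _ snd "\<lambda>j. (n - j, j)"]) auto
  finally show "ps_coeff (skew_schur \<alpha> \<beta> * S) m = ps_coeff (\<Sum>(i, j) \<in> {(i, j). i + j = n}.
      \<Sum>\<alpha>p\<in>?A i. \<Sum>\<beta>m\<in>?B j. (- 1) ^ j * skew_schur \<alpha>p \<beta>m) m"
    by (simp add: ps_coeff_sum case_prod_unfold)
qed

lemma row_fps_1: "row_fps (\<lambda>_. 1) k = (\<Sum>s\<le>k. fps_const (row_op (k - s)) * fps_X ^ s)"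
  by (simp add: row_fps_def)

lemma row_fps_le_1: "row_fps (\<lambda>s. if s \<le> 1 then 1 else 0) k =
  fps_const (row_op k) + (if k = 0 then 0 else fps_X * fps_const (row_op (k - 1)))"
proof (cases k)
  case (Suc j)
  have "row_fps (\<lambda>s. if s \<le> 1 then 1 else 0) k =
      (\<Sum>s\<in>{0, 1}. fps_const (of_nat (if s \<le> 1 then 1 else 0) * row_op (k - s)) * fps_X ^ s)"
    unfolding row_fps_def by (rule sum.mono_neutral_right) (auto simp: Suc)
  then show ?thesis by (simp add: Suc fps_mult_fps_X_commute)
qed (simp add: row_fps_def)

theorem theorem4p3:
  fixes \<alpha> \<beta> :: "nat list" and n :: nat
  assumes "is_composition \<alpha>" and "is_composition \<beta>" and "0 < n"
  shows "skew_schur \<alpha> \<beta> * quasi_schur [n] =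
      (\<Sum>(i, j) \<in> {(i, j). i + j = n}.
        \<Sum>\<alpha>p \<in> {\<alpha>p. is_composition \<alpha>p \<and> removes_horizontal_strip i \<alpha>p \<alpha>}.
        \<Sum>\<beta>m \<in> {\<beta>m. is_composition \<beta>m \<and> removes_vertical_strip j \<beta> \<beta>m}.
          (- 1) ^ j * skew_schur \<alpha>p \<beta>m)
    \<and> skew_schur \<alpha> \<beta> * quasi_schur (replicate n 1) =
      (\<Sum>(i, j) \<in> {(i, j). i + j = n}.
        \<Sum>\<alpha>p \<in> {\<alpha>p. is_composition \<alpha>p \<and> removes_vertical_strip i \<alpha>p \<alpha>}.
        \<Sum>\<beta>m \<in> {\<beta>m. is_composition \<beta>m \<and> removes_horizontal_strip j \<beta> \<beta>m}.
          (- 1) ^ j * skew_schur \<alpha>p \<beta>m)"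
proof
  have sets: "{\<gamma>. is_composition \<gamma> \<and> removes_horizontal_strip k \<gamma> \<alpha>} =
      {\<gamma>. is_composition \<gamma> \<and> strip (<) k \<gamma> \<alpha>}"
    "{\<gamma>. is_composition \<gamma> \<and> removes_vertical_strip k \<gamma> \<alpha>} =
      {\<gamma>. is_composition \<gamma> \<and> strip (\<ge>) k \<gamma> \<alpha>}" for k
    using strip_iff by auto
  have h: "Abs_fps (\<lambda>k. word_op rem_part (sorted_words (<) k)) = Abs_fps horizontal_op"
    and v: "Abs_fps (\<lambda>k. word_op rem_part (sorted_words (\<ge>) k)) = Abs_fps vertical_op"
    by (simp_all add: fps_eq_iff horizontal_op_def vertical_op_def)
  show "skew_schur \<alpha> \<beta> * quasi_schur [n] =
      (\<Sum>(i, j) \<in> {(i, j). i + j = n}.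
        \<Sum>\<alpha>p \<in> {\<alpha>p. is_composition \<alpha>p \<and> removes_horizontal_strip i \<alpha>p \<alpha>}.
        \<Sum>\<beta>m \<in> {\<beta>m. is_composition \<beta>m \<and> removes_vertical_strip j \<beta> \<beta>m}.
          (- 1) ^ j * skew_schur \<alpha>p \<beta>m)"
    unfolding strip_iff[OF assms(2)] sets
  proof (rule skew_pieri[where c = "\<lambda>_. 1", OF assms(1,2)])
    show "Abs_fps (\<lambda>k. (- 1) ^ k * word_op rem_part (sorted_words (\<ge>) k)) *
        Abs_fps (\<lambda>k. word_op rem_part (sorted_words (<) k)) = 1"
      unfolding h by (rule signed_vertical_horizontal[unfolded vertical_op_def])
    show "fps_const (row_op k) * Abs_fps (\<lambda>k. word_op rem_part (sorted_words (<) k)) =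
        Abs_fps (\<lambda>k. word_op rem_part (sorted_words (<) k)) * row_fps (\<lambda>_. 1) k" for k
      unfolding h row_fps_1 by (rule row_horizontal_fps)
  qed (use quasi_schur_row_coeff[OF assms(3)] in \<open>simp_all add: map_replicate_const\<close>)
  show "skew_schur \<alpha> \<beta> * quasi_schur (replicate n 1) =
      (\<Sum>(i, j) \<in> {(i, j). i + j = n}.
        \<Sum>\<alpha>p \<in> {\<alpha>p. is_composition \<alpha>p \<and> removes_vertical_strip i \<alpha>p \<alpha>}.
        \<Sum>\<beta>m \<in> {\<beta>m. is_composition \<beta>m \<and> removes_horizontal_strip j \<beta> \<beta>m}.
          (- 1) ^ j * skew_schur \<alpha>p \<beta>m)"
    unfolding strip_iff[OF assms(2)] sets
  proof (rule skew_pieri[where c = "\<lambda>s. if s \<le> 1 then 1 else 0", OF assms(1,2)])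
    show "Abs_fps (\<lambda>k. (- 1) ^ k * word_op rem_part (sorted_words (<) k)) *
        Abs_fps (\<lambda>k. word_op rem_part (sorted_words (\<ge>) k)) = 1"
      unfolding v by (rule horizontal_vertical[unfolded horizontal_op_def])
    show "fps_const (row_op k) * Abs_fps (\<lambda>k. word_op rem_part (sorted_words (\<ge>) k)) =
        Abs_fps (\<lambda>k. word_op rem_part (sorted_words (\<ge>) k)) *
          row_fps (\<lambda>s. if s \<le> 1 then 1 else 0) k" for k
      unfolding v row_fps_le_1 by (rule row_vertical_fps)
    show "ps_coeff (quasi_schur (replicate n 1)) b = (if sum_list (exps b r) = n
        then of_nat (prod_list (map (\<lambda>s. if s \<le> 1 then 1 else 0) (exps b r))) else 0)"
      if "\<forall>i\<ge>r. Poly_Mapping.lookup b i = 0" for b r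
      unfolding prod_list_le_1 quasi_schur_column_coeff[OF that] by simp
  qed simp_all
qed

end
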